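(* Let $G$ be a locally precompact group, with completion $\widetilde G$. The following statements are equivalent: (i) $G$ is locally realcompact, and $ip(G)<\mathfrak{m}$; (ii) $G$ is Dieudonné complete, and $ip(G)<\mathfrak{m}$; (iii) $G$ is locally Dieudonné complete, and $ip(G)<\mathfrak{m}$; (iv) $G$ is $G_\delta$-closed in $\widetilde G$, and $ip(G)<\mathfrak{m}$; (v) $\widetilde G$ is realcompact, and $G$ is $G_\delta$-closed in $\widetilde G$; (vi) $G$ is realcompact.
   Context: All topological spaces and topological groups are assumed to be Tychonoff (in particular Hausdorff); groups need not be abelian. "Neighborhood" means open set containing the point; $\mathcal{N}(G)$ is the collection of (open) neighborhoods of the identity of $G$. A subset $X$ of a topological group $G$ is precompact if for every $U\in\mathcal{N}(G)$ there is a finite $S\subseteq X$ with $X\subseteq (SU)\cap(US)$. For an infinite cardinal $\tau$, $X$ is $\tau$-precompact if for every $U\in\mathcal{N}(G)$ there is $S\subseteq X$ with $|S|\le\tau$ and $X\subseteq (SU)\cap(US)$. The precompactness index $ip(X)$ is the least infinite cardinal $\tau$ such that $X$ is $\tau$-precompact. $G$ is locally precompact if some non-empty open subset of $G$ is precompact; by Weil's theorem, this holds if and only if $G$ embeds as a dense topological subgroup of a locally compact group $\widetilde G$, which is then unique up to topological isomorphism fixing $G$ and is called the completion of $G$. $G$ is regarded as a subgroup of $\widetilde G$. A cardinal $\lambda$ is Ulam-measurable if there is a countably additive measure $\mu\colon\mathcal{P}(\lambda)\to\{0,1\}$ that is non-atomic (vanishes on singletons) with $\mu(\lambda)=1$.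 $\mathfrak{m}$ denotes the first Ulam-measurable cardinal (if it exists), and "$\lambda<\mathfrak{m}$" is used as shorthand for "$\lambda$ is not Ulam-measurable" (so it is true for every $\lambda$ if no Ulam-measurable cardinal exists). A $G_\delta$-subset of a space is a countable intersection of open sets; the $G_\delta$-topology is the topology generated by the $G_\delta$-subsets; a subset is $G_\delta$-closed if it is closed in the $G_\delta$-topology. A space is realcompact if it is homeomorphic to a closed subspace of $\mathbb{R}^\lambda$ for some cardinal $\lambda$. A space is Dieudonné complete if it is homeomorphic to a closed subspace of a product of metrizable spaces. A space $X$ is locally realcompact (respectively, locally Dieudonné complete) if every $x\in X$ has a neighborhood $U$ such that $\operatorname{cl}_X U$ is realcompact (respectively, Dieudonné complete). *)

theory Defs
  imports "HOL-Analysis.Analysis" "HOL-Algebra.Coset"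
begin

section \<open>Tychonoff topological groups\<close>

locale topological_group = group G for G (structure) +
  fixes T :: "'a topology"
  assumes topspace_eq: "topspace T = carrier G"
    and continuous_mult: "continuous_map (prod_topology T T) T (\<lambda>(x, y). x \<otimes> y)"
    and continuous_inv: "continuous_map T T (\<lambda>x. inv x)"
    and Hausdorff: "Hausdorff_space T"
    and completely_regular: "completely_regular_space T"

definition nhds_one :: "('a, 'm) monoid_scheme \<Rightarrow> 'a topology \<Rightarrow> 'a set set" where
  "nhds_one G T = {U. openin T U \<and> \<one>\<^bsub>G\<^esub> \<in> U}"

definition precompact_in :: "('a, 'm) monoid_scheme \<Rightarrow> 'a topology \<Rightarrow> 'a set \<Rightarrow> bool" where
  "precompact_in G T X \<longleftrightarrow>
     (\<forall>U\<in>nhds_one G T. \<exists>S. finite S \<and> S \<subseteq> X \<and> X \<subseteq> (S <#>\<^bsub>G\<^esub> U) \<inter> (U <#>\<^bsub>G\<^esub> S))"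

definition locally_precompact :: "('a, 'm) monoid_scheme \<Rightarrow> 'a topology \<Rightarrow> bool" where
  "locally_precompact G T \<longleftrightarrow> (\<exists>V. openin T V \<and> V \<noteq> {} \<and> precompact_in G T V)"

text \<open>The completion: a locally compact group together with an embedding \<open>e\<close> of \<open>G\<close> onto a dense
  topological subgroup. Regarding \<open>G\<close> as an actual subgroup is the case where \<open>e\<close> is the identity.\<close>

definition is_completion ::
  "('a, 'm) monoid_scheme \<Rightarrow> 'a topology \<Rightarrow> ('b, 'n) monoid_scheme \<Rightarrow> 'b topology \<Rightarrow> ('a \<Rightarrow> 'b) \<Rightarrow> bool" where
  "is_completion G T H T' e \<longleftrightarrow>
     topological_group H T' \<and> locally_compact_space T' \<and>
     e \<in> hom G H \<and> embedding_map T T' e \<and> T' closure_of (e ` carrier G) = topspace T'"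


section \<open>Cardinals and the precompactness index\<close>

text \<open>Cardinals are represented, as in the library, by minimal well-orders \<open>r\<close>; the underlying set
  is \<open>Field r\<close>.\<close>

definition card_precompact_in ::
  "('a, 'm) monoid_scheme \<Rightarrow> 'a topology \<Rightarrow> 'c rel \<Rightarrow> 'a set \<Rightarrow> bool" where
  "card_precompact_in G T \<tau> X \<longleftrightarrow>
     (\<forall>U\<in>nhds_one G T. \<exists>S. S \<subseteq> X \<and> (card_of S, \<tau>) \<in> ordLeq \<and>
        X \<subseteq> (S <#>\<^bsub>G\<^esub> U) \<inter> (U <#>\<^bsub>G\<^esub> S))"

text \<open>The index is determined up to \<^const>\<open>ordIso\<close>. It never exceeds \<open>max |X| \<aleph>\<^sub>0\<close>, so a
  representative on the type \<open>'a + nat\<close> exists; \<open>precompactness_index_least\<close> below shows that it is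
  least among the infinite cardinals on all types.\<close>

definition precompactness_index ::
  "('a, 'm) monoid_scheme \<Rightarrow> 'a topology \<Rightarrow> 'a set \<Rightarrow> ('a + nat) rel" where
  "precompactness_index G T X = (SOME \<tau>.
     Card_order \<tau> \<and> infinite (Field \<tau>) \<and> card_precompact_in G T \<tau> X \<and>
     (\<forall>\<sigma> :: ('a + nat) rel.
        Card_order \<sigma> \<and> infinite (Field \<sigma>) \<and> card_precompact_in G T \<sigma> X \<longrightarrow> (\<tau>, \<sigma>) \<in> ordLeq))"

definition Ulam_measurable :: "'c rel \<Rightarrow> bool" where
  "Ulam_measurable \<kappa> \<longleftrightarrow>
     (\<exists>\<mu> :: 'c measure. space \<mu> = Field \<kappa> \<and> sets \<mu> = Pow (Field \<kappa>) \<and>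
        (\<forall>A\<in>sets \<mu>. emeasure \<mu> A \<in> {0, 1}) \<and>
        (\<forall>x\<in>Field \<kappa>. emeasure \<mu> {x} = 0) \<and> emeasure \<mu> (Field \<kappa>) = 1)"

lemma card_precompact_in_mono:
  assumes "card_precompact_in G T \<tau> X" "(\<tau>, \<sigma>) \<in> ordLeq"
  shows "card_precompact_in G T \<sigma> X"
  using assms unfolding card_precompact_in_def by (meson ordLeq_transitive)

lemma card_precompact_in_exists:
  assumes "topological_group G T" "X \<subseteq> carrier G"
  shows "card_precompact_in G T (card_of (UNIV :: ('a + nat) set)) (X :: 'a set)"
proof -
  interpret topological_group G T by fact
  have "X \<subseteq> X <#>\<^bsub>G\<^esub> U" "X \<subseteq> U <#>\<^bsub>G\<^esub> X" if "\<one>\<^bsub>G\<^esub> \<in> U" for U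
    using that assms(2) unfolding set_mult_def by force+
  moreover have "(card_of X, card_of (UNIV :: ('a + nat) set)) \<in> ordLeq"
    by (rule ordLeq_transitive[OF card_of_mono1[OF subset_UNIV]])
      (auto intro!: card_of_ordLeqI[of Inl])
  ultimately show ?thesis
    unfolding card_precompact_in_def nhds_one_def by blast
qed

lemma precompactness_index:
  fixes X :: "'a set"
  assumes "topological_group G T" "X \<subseteq> carrier G"
  shows "Card_order (precompactness_index G T X)"
    and "infinite (Field (precompactness_index G T X))"
    and "card_precompact_in G T (precompactness_index G T X) X"
    and precompactness_index_least_aux: "\<And>\<sigma> :: ('a + nat) rel.
       Card_order \<sigma> \<Longrightarrow> infinite (Field \<sigma>) \<Longrightarrow> card_precompact_in G T \<sigma> X \<Longrightarrow>
       (precompactness_index G T X, \<sigma>) \<in> ordLeq"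
proof -
  let ?P = "\<lambda>\<tau> :: ('a + nat) rel.
    Card_order \<tau> \<and> infinite (Field \<tau>) \<and> card_precompact_in G T \<tau> X"
  have ne: "Collect ?P \<noteq> {}"
    using card_precompact_in_exists[OF assms] card_of_Card_order
    by (auto simp: Field_card_of intro!: exI[of _ "card_of UNIV"])
  have "\<forall>\<tau>\<in>Collect ?P. Well_order \<tau>"
    by (auto simp: card_order_on_def)
  from exists_minim_Well_order[OF ne this]
  have "\<exists>\<tau>. ?P \<tau> \<and> (\<forall>\<sigma>. ?P \<sigma> \<longrightarrow> (\<tau>, \<sigma>) \<in> ordLeq)"
    by blast
  hence "\<exists>\<tau> :: ('a + nat) rel. Card_order \<tau> \<and> infinite (Field \<tau>) \<and> card_precompact_in G T \<tau> X \<and>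
     (\<forall>\<sigma> :: ('a + nat) rel. ?P \<sigma> \<longrightarrow> (\<tau>, \<sigma>) \<in> ordLeq)"
    by blast
  from someI_ex[OF this, folded precompactness_index_def]
  show "Card_order (precompactness_index G T X)"
    and "infinite (Field (precompactness_index G T X))"
    and "card_precompact_in G T (precompactness_index G T X) X"
    and "\<And>\<sigma> :: ('a + nat) rel.
       Card_order \<sigma> \<Longrightarrow> infinite (Field \<sigma>) \<Longrightarrow> card_precompact_in G T \<sigma> X \<Longrightarrow>
       (precompactness_index G T X, \<sigma>) \<in> ordLeq"
    by blast+
qed

lemma precompactness_index_least:
  fixes X :: "'a set" and \<sigma> :: "'c rel"
  assumes "topological_group G T" "X \<subseteq> carrier G"
    and \<sigma>: "Card_order \<sigma>" "infinite (Field \<sigma>)" "card_precompact_in G T \<sigma> X"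
  shows "(precompactness_index G T X, \<sigma>) \<in> ordLeq"
proof -
  let ?U = "card_of (UNIV :: ('a + nat) set)"
  consider "(?U, \<sigma>) \<in> ordLeq" | "(\<sigma>, ?U) \<in> ordLeq"
    using ordLeq_total[of ?U \<sigma>] \<sigma>(1) card_of_Well_order by (auto simp: card_order_on_def)
  then show ?thesis
  proof cases
    case 1
    have "(precompactness_index G T X, ?U) \<in> ordLeq"
      by (rule precompactness_index_least_aux[OF assms(1,2)])
        (auto simp: Field_card_of card_of_card_order_on card_precompact_in_exists[OF assms(1,2)])
    then show ?thesis using 1 ordLeq_transitive by blast
  next
    case 2
    have iso: "(card_of (Field \<sigma>), \<sigma>) \<in> ordIso"
      using \<sigma>(1) by (rule card_of_Field_ordIso)
    have "(card_of (Field \<sigma>), ?U) \<in> ordLeq"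
      using iso 2 ordIso_ordLeq_trans by blast
    then obtain f where f: "inj_on f (Field \<sigma>)" "f ` Field \<sigma> \<subseteq> (UNIV :: ('a + nat) set)"
      using card_of_ordLeq by metis
    define B where "B = f ` Field \<sigma>"
    have "(card_of (Field \<sigma>), card_of B) \<in> ordIso"
      using f(1) card_of_ordIso unfolding B_def bij_betw_def by blast
    then have B: "(\<sigma>, card_of B) \<in> ordIso"
      using iso ordIso_symmetric ordIso_transitive by blast
    have "infinite B"
      using \<sigma>(2) f(1) unfolding B_def by (simp add: finite_image_iff)
    moreover have "card_precompact_in G T (card_of B) X"
      using \<sigma>(3) B card_precompact_in_mono ordIso_iff_ordLeq by blast
    ultimately have "(precompactness_index G T X, card_of B) \<in> ordLeq"
      by (intro precompactness_index_least_aux[OF assms(1,2)])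
        (auto simp: Field_card_of card_of_card_order_on)
    then show ?thesis
      using B ordIso_symmetric ordLeq_ordIso_trans by blast
  qed
qed


section \<open>The \<open>G\<^sub>\<delta>\<close>-topology\<close>

definition gdelta_topology :: "'a topology \<Rightarrow> 'a topology" where
  "gdelta_topology T = topology_generated_by {S. gdelta_in T S}"

definition gdelta_closedin :: "'a topology \<Rightarrow> 'a set \<Rightarrow> bool" where
  "gdelta_closedin T S \<longleftrightarrow> closedin (gdelta_topology T) S"

lemma topspace_gdelta_topology: "topspace (gdelta_topology T) = topspace T"
  using gdelta_in_subset[of T] gdelta_in_topspace[of T]
  by (fastforce simp: gdelta_topology_def)


section \<open>Realcompact and Dieudonne complete spaces\<close>

text \<open>The two definitions below quantify over a power of the real line and over a product of
  metrizable spaces. HOL cannot quantify over types inside a formula, so the index sets and the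
  metrizable factors live on types built from \<open>'a\<close>. The lemmas \<open>realcompact_spaceI\<close> and
  \<open>Dieudonne_complete_spaceI\<close> show that this loses nothing: index sets and factors on arbitrary
  types yield the same notions.\<close>

definition realcompact_space :: "'a topology \<Rightarrow> bool" where
  "realcompact_space X \<longleftrightarrow>
     (\<exists>(I :: ('a \<Rightarrow> real) set) C.
        closedin (product_topology (\<lambda>_. euclideanreal) I) C \<and>
        X homeomorphic_space subtopology (product_topology (\<lambda>_. euclideanreal) I) C)"

definition Dieudonne_complete_space :: "'a topology \<Rightarrow> bool" where
  "Dieudonne_complete_space X \<longleftrightarrow>
     (\<exists>(I :: ('a topology \<times> ('a \<Rightarrow> 'a)) set) (M :: _ \<Rightarrow> 'a topology) C.
        (\<forall>i\<in>I. metrizable_space (M i)) \<and>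
        closedin (product_topology M I) C \<and>
        X homeomorphic_space subtopology (product_topology M I) C)"

definition locally_realcompact_space :: "'a topology \<Rightarrow> bool" where
  "locally_realcompact_space X \<longleftrightarrow>
     (\<forall>x\<in>topspace X. \<exists>U. openin X U \<and> x \<in> U \<and>
        realcompact_space (subtopology X (X closure_of U)))"

definition locally_Dieudonne_complete_space :: "'a topology \<Rightarrow> bool" where
  "locally_Dieudonne_complete_space X \<longleftrightarrow>
     (\<forall>x\<in>topspace X. \<exists>U. openin X U \<and> x \<in> U \<and>
        Dieudonne_complete_space (subtopology X (X closure_of U)))"

text \<open>Reindexing a closed embedding \<open>h\<close> into a product: coordinates with the same label \<open>k i\<close> are
  merged, and each factor is replaced by one that maps injectively into it.\<close>

lemma closed_in_product_reindex:
  fixes X :: "'a topology" and Y :: "'i \<Rightarrow> 'b topology" and Z :: "'j \<Rightarrow> 'c topology"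
  assumes C: "closedin (product_topology Y I) C"
    and h: "homeomorphic_map X (subtopology (product_topology Y I) C) h"
    and q: "\<And>i. i \<in> I \<Longrightarrow> continuous_map X (Z (k i)) (q (k i))"
    and d: "\<And>i. i \<in> I \<Longrightarrow> continuous_map (Z (k i)) (Y i) (d i)"
    and inj: "\<And>i. i \<in> I \<Longrightarrow> inj_on (d i) (topspace (Z (k i)))"
    and dq: "\<And>i x. i \<in> I \<Longrightarrow> x \<in> topspace X \<Longrightarrow> d i (q (k i) x) = h x i"
  shows "\<exists>D. closedin (product_topology Z (k ` I)) D \<and>
             X homeomorphic_space subtopology (product_topology Z (k ` I)) D"
proof -
  let ?PY = "product_topology Y I" and ?PZ = "product_topology Z (k ` I)"
  define F where "F x = (\<lambda>j\<in>k ` I. q j x)" for x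
  define \<Phi> where "\<Phi> z = (\<lambda>i\<in>I. d i (z (k i)))" for z
  define D where "D = {z \<in> topspace ?PZ. \<Phi> z \<in> C}"
  have CY: "C \<subseteq> topspace ?PY" using C closedin_subset by blast
  have hX: "h ` topspace X = C"
    using homeomorphic_imp_surjective_map[OF h] CY by (auto simp: topspace_subtopology)
  have cF: "continuous_map X ?PZ F"
    using q unfolding F_def by (auto simp: continuous_map_componentwise)
  have c\<Phi>: "continuous_map ?PZ ?PY \<Phi>"
    unfolding \<Phi>_def continuous_map_componentwise
  proof (intro conjI ballI)
    fix i assume i: "i \<in> I"
    have "continuous_map ?PZ (Y i) (d i \<circ> (\<lambda>z. z (k i)))"
      by (rule continuous_map_compose[OF _ d[OF i]])
        (use i in \<open>auto intro: continuous_map_product_projection\<close>)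
    then show "continuous_map ?PZ (Y i) (\<lambda>z. (\<lambda>i\<in>I. d i (z (k i))) i)"
      using i by (simp add: o_def)
  qed auto
  have D: "closedin ?PZ D"
    unfolding D_def by (rule closedin_continuous_map_preimage[OF c\<Phi> C])
  have \<Phi>F: "\<Phi> (F x) = h x" if x: "x \<in> topspace X" for x
  proof
    have "h x \<in> extensional I"
      using hX CY x by (force simp: topspace_product_topology PiE_def)
    then show "\<Phi> (F x) i = h x i" for i
      using x dq by (auto simp: \<Phi>_def F_def extensional_def)
  qed
  have FD: "F x \<in> D" if "x \<in> topspace X" for x
    using that \<Phi>F hX continuous_map_image_subset_topspace[OF cF] by (auto simp: D_def)
  obtain g where g: "homeomorphic_maps X (subtopology ?PY C) h g"
    using h homeomorphic_map_maps by blast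
  have gh: "g (h x) = x" if "x \<in> topspace X" for x
    using g that by (auto simp: homeomorphic_maps_def)
  have Fg: "F (g (\<Phi> z)) = z" if z: "z \<in> D" for z
  proof -
    have "\<Phi> z \<in> C" and zt: "z \<in> topspace ?PZ" using z by (auto simp: D_def)
    then obtain x where x: "x \<in> topspace X" "\<Phi> z = h x" using hX by auto
    have "z (k i) = q (k i) x" if i: "i \<in> I" for i
    proof -
      have "d i (z (k i)) = d i (q (k i) x)"
        using fun_cong[OF x(2), of i] i dq[OF i x(1)] by (simp add: \<Phi>_def)
      moreover have "z (k i) \<in> topspace (Z (k i))"
        using zt i by (auto simp: topspace_product_topology)
      moreover have "q (k i) x \<in> topspace (Z (k i))"
        using continuous_map_image_subset_topspace[OF q[OF i]] x(1) by auto
      ultimately show ?thesis using inj[OF i] by (auto dest: inj_onD)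
    qed
    moreover have "z \<in> extensional (k ` I)"
      using zt by (auto simp: topspace_product_topology PiE_def)
    ultimately have "F x = z"
      by (auto simp: F_def extensional_def fun_eq_iff)
    then show ?thesis using x gh by simp
  qed
  have "homeomorphic_maps X (subtopology ?PZ D) F (g \<circ> \<Phi>)"
    unfolding homeomorphic_maps_def
  proof (intro conjI ballI)
    show "continuous_map X (subtopology ?PZ D) F"
      using cF FD by (auto simp: continuous_map_in_subtopology)
    have "continuous_map (subtopology ?PZ D) (subtopology ?PY C) \<Phi>"
      using continuous_map_from_subtopology[OF c\<Phi>]
      by (auto simp: continuous_map_in_subtopology D_def)
    moreover have "continuous_map (subtopology ?PY C) X g"
      using g by (simp add: homeomorphic_maps_def)
    ultimately show "continuous_map (subtopology ?PZ D) X (g \<circ> \<Phi>)"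
      by (rule continuous_map_compose)
  qed (use \<Phi>F gh Fg in auto)
  then show ?thesis using D homeomorphic_maps_imp_homeomorphic_space by blast
qed

lemma realcompact_spaceI:
  fixes X :: "'a topology" and I :: "'i set"
  assumes C: "closedin (product_topology (\<lambda>_. euclideanreal) I) C"
    and "X homeomorphic_space subtopology (product_topology (\<lambda>_. euclideanreal) I) C"
  shows "realcompact_space X"
proof -
  obtain h where h: "homeomorphic_map X (subtopology (product_topology (\<lambda>_. euclideanreal) I) C) h"
    using assms(2) homeomorphic_space by blast
  then have "continuous_map X (product_topology (\<lambda>_. euclideanreal) I) h"
    using homeomorphic_imp_continuous_map continuous_map_in_subtopology by blast
  then have "continuous_map X euclideanreal (\<lambda>x. h x i)" if "i \<in> I" for i
    using that by (auto simp: continuous_map_componentwise)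
  then have "\<exists>D. closedin (product_topology (\<lambda>_. euclideanreal) ((\<lambda>i x. h x i) ` I)) D \<and>
      X homeomorphic_space subtopology (product_topology (\<lambda>_. euclideanreal) ((\<lambda>i x. h x i) ` I)) D"
    by (intro closed_in_product_reindex[OF C h, where q = "\<lambda>j. j" and d = "\<lambda>_ y. y"]) auto
  then show ?thesis unfolding realcompact_space_def by blast
qed

lemma Dieudonne_complete_spaceI:
  fixes X :: "'a topology" and I :: "'i set" and Y :: "'i \<Rightarrow> 'b topology"
  assumes M: "\<And>i. i \<in> I \<Longrightarrow> metrizable_space (Y i)"
    and C: "closedin (product_topology Y I) C"
    and "X homeomorphic_space subtopology (product_topology Y I) C"
  shows "Dieudonne_complete_space X"
proof -
  obtain h where h: "homeomorphic_map X (subtopology (product_topology Y I) C) h"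
    using assms(3) homeomorphic_space by blast
  then have "continuous_map X (product_topology Y I) h"
    using homeomorphic_imp_continuous_map continuous_map_in_subtopology by blast
  then have hi: "continuous_map X (Y i) (\<lambda>x. h x i)" if "i \<in> I" for i
    using that by (auto simp: continuous_map_componentwise)
  define s where "s i = inv_into (topspace X) (\<lambda>x. h x i)" for i
  define R where "R i = (\<lambda>x. s i (h x i)) ` topspace X" for i
  define N where "N i = pullback_topology (R i) (\<lambda>x. h x i) (Y i)" for i
  define k where "k i = (N i, \<lambda>x. s i (h x i))" for i
  have hs: "h (s i (h x i)) i = h x i" if "x \<in> topspace X" for i x
    unfolding s_def using f_inv_into_f[of "h x i" "\<lambda>x. h x i" "topspace X"] that by blast
  have RX: "R i \<subseteq> topspace X" for i
    unfolding R_def s_def by (auto intro!: inv_into_into)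
  have tN: "topspace (N i) = R i" if "i \<in> I" for i
    using RX[of i] continuous_map_image_subset_topspace[OF hi[OF that]]
    by (auto simp: N_def topspace_pullback_topology image_subset_iff)
  have injR: "inj_on (\<lambda>x. h x i) (R i)" for i
    unfolding R_def inj_on_def using hs by auto
  have cN: "continuous_map (N i) (Y i) (\<lambda>x. h x i)" if "i \<in> I" for i
    using continuous_map_pullback[of "Y i" "Y i" "\<lambda>y. y" "R i" "\<lambda>x. h x i"]
    by (simp add: N_def o_def)
  have qN: "continuous_map X (N i) (\<lambda>x. s i (h x i))" if "i \<in> I" for i
    unfolding N_def
  proof (rule continuous_map_pullback')
    show "continuous_map X (Y i) ((\<lambda>x. h x i) \<circ> (\<lambda>x. s i (h x i)))"
      using hi[OF that] by (rule continuous_map_eq) (auto simp: hs)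
  qed (auto simp: R_def)
  have mN: "metrizable_space (N i)" if i: "i \<in> I" for i
  proof -
    have "homeomorphic_map (N i) (subtopology (Y i) ((\<lambda>x. h x i) ` topspace (N i))) (\<lambda>x. h x i)"
    proof (rule bijective_open_imp_homeomorphic_map)
      show "continuous_map (N i) (subtopology (Y i) ((\<lambda>x. h x i) ` topspace (N i))) (\<lambda>x. h x i)"
        using cN[OF i] by (auto simp: continuous_map_in_subtopology)
      show "open_map (N i) (subtopology (Y i) ((\<lambda>x. h x i) ` topspace (N i))) (\<lambda>x. h x i)"
        unfolding open_map_def tN[OF i]
        by (fastforce simp: N_def openin_pullback_topology openin_subtopology)
      show "(\<lambda>x. h x i) ` topspace (N i) =
          topspace (subtopology (Y i) ((\<lambda>x. h x i) ` topspace (N i)))"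
        using continuous_map_image_subset_topspace[OF cN[OF i]]
        by (auto simp: topspace_subtopology)
      show "inj_on (\<lambda>x. h x i) (topspace (N i))"
        using injR tN[OF i] by simp
    qed
    then show ?thesis
      using M[OF i] metrizable_space_subtopology homeomorphic_metrizable_space
        homeomorphic_map_imp_homeomorphic_space by blast
  qed
  have "\<exists>D. closedin (product_topology fst (k ` I)) D \<and>
      X homeomorphic_space subtopology (product_topology fst (k ` I)) D"
    by (intro closed_in_product_reindex[OF C h, where q = snd and d = "\<lambda>i x. h x i"])
      (auto simp: k_def qN cN tN injR hs)
  moreover have "\<forall>j\<in>k ` I. metrizable_space (fst j)"
    using mN by (auto simp: k_def)
  ultimately show ?thesis
    unfolding Dieudonne_complete_space_def by blast
qed

end

theory Submission
  imports Defs
begin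

text \<open>A filter on a Tychonoff space \<open>X\<close> is called real if it is countably complete and every continuous
  real function is eventually constant along it; \<open>X\<close> is realcompact iff every real filter converges.
  Hence realcompactness passes to \<open>G\<^sub>\<delta>\<close>-closed subspaces: the limit of a real filter living on such a
  subspace lies in it.

  The completion has an open \<open>\<sigma>\<close>-compact subgroup \<open>L\<close>, and up to a factor \<open>\<aleph>\<^sub>0\<close> the index \<open>ip(G)\<close> is the
  number of its cosets. As the cosets are clopen, real filters induce countably complete ultrafilters
  on the set of cosets and, for realcompact \<open>G\<close>, conversely such ultrafilters are principal. This
  links realcompactness to the non-measurability of \<open>ip(G)\<close>.

  Finally, a continuous function from a neighbourhood in \<open>G\<close> to a metrizable space has a limit at every
  nearby point of the \<open>G\<^sub>\<delta>\<close>-closure of \<open>G\<close>, by an argument with \<open>G\<^sub>\<delta>\<close>-subgroups of the completion. If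
  \<open>G\<close> is locally Dieudonne complete, this forces such points to belong to \<open>G\<close>.\<close>

section \<open>Real filters\<close>

definition countably_complete :: "'a filter \<Rightarrow> bool" where
  "countably_complete F \<longleftrightarrow>
     (\<forall>P :: nat \<Rightarrow> 'a \<Rightarrow> bool. (\<forall>n. eventually (P n) F) \<longrightarrow> eventually (\<lambda>x. \<forall>n. P n x) F)"

lemma countably_completeD:
  "countably_complete F \<Longrightarrow> (\<And>n. eventually (P n) F) \<Longrightarrow> eventually (\<lambda>x. \<forall>n::nat. P n x) F"
  unfolding countably_complete_def by blast

lemma countably_complete_ball:
  assumes F: "countably_complete F" and A: "countable A" and P: "\<And>a. a \<in> A \<Longrightarrow> eventually (P a) F"
  shows "eventually (\<lambda>x. \<forall>a\<in>A. P a x) F"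
proof (cases "A = {}")
  case False
  have "eventually (\<lambda>x. \<forall>n. P (from_nat_into A n) x) F"
    using from_nat_into[OF False] P by (intro countably_completeD[OF F]) blast
  then show ?thesis
    by (rule eventually_mono) (metis A from_nat_into_surj)
qed simp

text \<open>The filter counterpart of a real z-ultrafilter: continuous real functions have to be
  decided, arbitrary subsets do not.\<close>

definition real_filter :: "'a topology \<Rightarrow> 'a filter \<Rightarrow> bool" where
  "real_filter X F \<longleftrightarrow> F \<noteq> bot \<and> eventually (\<lambda>x. x \<in> topspace X) F \<and> countably_complete F \<and>
     (\<forall>f. continuous_map X euclideanreal f \<longrightarrow> (\<exists>c. eventually (\<lambda>x. f x = c) F))"

text \<open>Coordinatewise limits assemble to a limit of \<open>h\<close> in the product, closedness
  puts it into \<open>C\<close>, and the inverse homeomorphism carries it back to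
  \<open>X\<close>.\<close>

lemma closed_in_product_limit:
  assumes C: "closedin (product_topology Y I) C"
    and h: "homeomorphic_map X (subtopology (product_topology Y I) C) h"
    and F: "F \<noteq> bot" "eventually (\<lambda>x. x \<in> topspace X) F"
    and lim: "\<And>i. i \<in> I \<Longrightarrow> \<exists>z. limitin (Y i) (\<lambda>x. h x i) z F"
  shows "\<exists>p. limitin X (\<lambda>x. x) p F"
proof -
  let ?P = "product_topology Y I"
  obtain g where g: "homeomorphic_maps X (subtopology ?P C) h g"
    using h homeomorphic_map_maps by blast
  have hX: "h x \<in> topspace ?P \<inter> C" if "x \<in> topspace X" for x
    using that homeomorphic_imp_surjective_map[OF h] by auto
  obtain z where z: "\<And>i. i \<in> I \<Longrightarrow> limitin (Y i) (\<lambda>x. h x i) (z i) F"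
    using lim by metis
  have "limitin ?P h (restrict z I) F"
    unfolding limitin_componentwise using F(2) z hX
    by (auto elim!: eventually_mono)
  moreover have ev: "eventually (\<lambda>x. h x \<in> C) F"
    using F(2) by (rule eventually_mono) (use hX in blast)
  moreover have "restrict z I \<in> C"
    by (rule limitin_closedin[OF calculation(1) C ev F(1)])
  ultimately have "limitin (subtopology ?P C) h (restrict z I) F"
    by (simp add: limitin_subtopology)
  then have "limitin X (g \<circ> h) (g (restrict z I)) F"
    using g unfolding homeomorphic_maps_def by (blast intro: continuous_map_limit)
  moreover have "eventually (\<lambda>x. (g \<circ> h) x = x) F"
    using F(2) by (rule eventually_mono) (use g in \<open>auto simp: homeomorphic_maps_def\<close>)
  ultimately show ?thesis
    using limitin_transform_eventually[of "g \<circ> h" "\<lambda>x. x"] by (intro exI)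
qed

lemma realcompact_imp_real_filter_converges:
  assumes "realcompact_space X" "real_filter X F"
  shows "\<exists>p. limitin X (\<lambda>x. x) p F"
proof -
  obtain I :: "('a \<Rightarrow> real) set" and C h where
    C: "closedin (product_topology (\<lambda>_. euclideanreal) I) C"
    and h: "homeomorphic_map X (subtopology (product_topology (\<lambda>_. euclideanreal) I) C) h"
    using assms(1) unfolding realcompact_space_def homeomorphic_space by blast
  have "continuous_map X (product_topology (\<lambda>_. euclideanreal) I) h"
    using h homeomorphic_imp_continuous_map continuous_map_in_subtopology by blast
  then have "continuous_map X euclideanreal (\<lambda>x. h x i)" if "i \<in> I" for i
    using that by (auto simp: continuous_map_componentwise)
  then have "\<exists>z. limitin euclideanreal (\<lambda>x. h x i) z F" if "i \<in> I" for i
    using assms(2) that limitin_eventually[of _ euclideanreal] unfolding real_filter_def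
    by (metis UNIV_I topspace_euclidean)
  then show ?thesis
    using assms(2) closed_in_product_limit[OF C h] unfolding real_filter_def by blast
qed

text \<open>If the functions of \<open>A\<close> never took the values prescribed by \<open>z\<close> simultaneously, the
  reciprocal of their distance to these values would be a continuous function with no value
  compatible with \<open>z\<close>.\<close>

lemma closure_of_evaluations_countable:
  fixes X :: "'a topology"
  defines "I \<equiv> {f. continuous_map X euclideanreal f}"
  assumes z: "z \<in> product_topology (\<lambda>_. euclideanreal) I closure_of ((\<lambda>x. \<lambda>f\<in>I. f x) ` topspace X)"
    and A: "countable A" "A \<subseteq> I"
  shows "\<exists>x\<in>topspace X. \<forall>f\<in>A. f x = z f"
proof (rule ccontr)
  assume no: "\<not> ?thesis"
  let ?P = "product_topology (\<lambda>_. euclideanreal) I"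
  have approx: "\<exists>x\<in>topspace X. (\<lambda>f\<in>I. f x) \<in> U" if "openin ?P U" "z \<in> U" for U
    using z that unfolding in_closure_of by blast
  have zP: "z \<in> topspace ?P"
    by (rule subsetD[OF closure_of_subset_topspace z])
  have "A \<noteq> {}"
    using no approx[OF openin_topspace zP] by auto
  define a where "a = from_nat_into A"
  have a: "range a = A" and aI: "a n \<in> I" for n
    using range_from_nat_into[OF \<open>A \<noteq> {}\<close> A(1)] A(2) unfolding a_def by auto
  \<comment> \<open>Collecting the coordinates in \<open>A\<close> into one real sequence makes
    \<open>\<phi>\<close> a single continuous function that vanishes exactly where all of them agree
    with \<open>z\<close>.\<close>
  define \<pi> where "\<pi> y n = (y (a n) :: real)" for y n
  define \<phi> where "\<phi> y = dist (\<pi> y) (\<pi> z)" for y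
  have c\<pi>: "continuous_map ?P euclidean \<pi>"
    unfolding euclidean_product_topology[symmetric] \<pi>_def continuous_map_componentwise
    using aI by (auto intro: continuous_map_product_projection)
  have c\<phi>: "continuous_map ?P euclideanreal \<phi>"
  proof -
    have "continuous_map euclidean euclideanreal (\<lambda>w. dist w (\<pi> z))"
      unfolding continuous_map_iff_continuous2 by (intro continuous_intros)
    from continuous_map_compose[OF c\<pi> this] show ?thesis
      by (simp add: \<phi>_def[abs_def] o_def)
  qed
  have cj: "continuous_map X ?P (\<lambda>x. \<lambda>f\<in>I. f x)"
    by (auto simp: continuous_map_componentwise I_def)
  define \<psi> where "\<psi> x = inverse (\<phi> (\<lambda>f\<in>I. f x))" for x
  have pos: "\<phi> (\<lambda>f\<in>I. f x) > 0" if "x \<in> topspace X" for x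
  proof -
    have "\<pi> (\<lambda>f\<in>I. f x) \<noteq> \<pi> z"
    proof
      assume eq: "\<pi> (\<lambda>f\<in>I. f x) = \<pi> z"
      have "a n x = z (a n)" for n
        using fun_cong[OF eq, of n] aI by (simp add: \<pi>_def)
      then show False
        using no that unfolding a[symmetric] by blast
    qed
    then show ?thesis by (simp add: \<phi>_def)
  qed
  have "continuous_map X euclideanreal \<psi>"
    unfolding \<psi>_def using continuous_map_compose[OF cj c\<phi>] pos
    by (intro continuous_map_real_inverse) (fastforce simp: o_def)+
  then have \<psi>I: "\<psi> \<in> I" by (simp add: I_def)
  \<comment> \<open>If \<open>\<phi>\<close> is below \<open>\<epsilon>\<close> at the evaluation of
    \<open>x\<close>, then \<open>\<psi> x\<close> exceeds \<open>\<bar>z \<psi>\<bar> + 1\<close>,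
    so it cannot be within 1 of \<open>z \<psi>\<close>.\<close>
  define \<epsilon> where "\<epsilon> = inverse (\<bar>z \<psi>\<bar> + 1)"
  have \<epsilon>: "\<epsilon> > 0" by (simp add: \<epsilon>_def add_nonneg_pos)
  let ?U = "{y \<in> topspace ?P. \<phi> y \<in> {..<\<epsilon>}} \<inter> {y \<in> topspace ?P. y \<psi> \<in> {z \<psi> - 1<..<z \<psi> + 1}}"
  have "openin ?P ?U"
    using \<psi>I by (intro openin_Int openin_continuous_map_preimage[OF c\<phi>]
        openin_continuous_map_preimage[OF continuous_map_product_projection]) auto
  moreover have "z \<in> ?U"
    using zP \<epsilon> by (simp add: \<phi>_def)
  ultimately obtain x where x: "x \<in> topspace X" and xU: "(\<lambda>f\<in>I. f x) \<in> ?U"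
    using approx by blast
  then have "\<phi> (\<lambda>f\<in>I. f x) < \<epsilon>" "\<psi> x < z \<psi> + 1"
    using \<psi>I by auto
  then have "inverse \<epsilon> < \<psi> x"
    using pos[OF x] unfolding \<psi>_def by (simp add: less_imp_inverse_less)
  then show False
    using \<open>\<psi> x < z \<psi> + 1\<close> by (simp add: \<epsilon>_def)
qed

text \<open>The Tychonoff embedding: complete regularity gives enough real functions to separate
  points from closed sets, hence injectivity and openness onto the image.\<close>

lemma evaluations_homeomorphic_map:
  fixes X :: "'a topology"
  defines "I \<equiv> {f. continuous_map X euclideanreal f}"
  assumes "Hausdorff_space X" "completely_regular_space X"
  shows "homeomorphic_map X (subtopology (product_topology (\<lambda>_. euclideanreal) I)
           ((\<lambda>x. \<lambda>f\<in>I. f x) ` topspace X)) (\<lambda>x. \<lambda>f\<in>I. f x)"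
proof (rule bijective_open_imp_homeomorphic_map)
  let ?P = "product_topology (\<lambda>_. euclideanreal) I"
  let ?j = "\<lambda>x. \<lambda>f\<in>I. f x :: real"
  have cj: "continuous_map X ?P ?j"
    by (auto simp: continuous_map_componentwise I_def)
  then show "continuous_map X (subtopology ?P (?j ` topspace X)) ?j"
    by (auto simp: continuous_map_in_subtopology)
  show "?j ` topspace X = topspace (subtopology ?P (?j ` topspace X))"
    by auto
  have sep: "\<exists>f\<in>I. f x = 0 \<and> f ` (topspace X - U) \<subseteq> {1}" if "openin X U" "x \<in> U" for x U
    using assms(3) that unfolding completely_regular_space_alt' I_def by blast
  show "inj_on ?j (topspace X)"
  proof (rule inj_onI, rule ccontr)
    fix x y assume xy: "x \<in> topspace X" "y \<in> topspace X" "?j x = ?j y" "x \<noteq> y"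
    then obtain U where "openin X U" "x \<in> U" "y \<notin> U"
      using assms(2) unfolding Hausdorff_space_def disjnt_iff by metis
    then obtain f where f: "f \<in> I" "f x = 0" "f ` (topspace X - U) \<subseteq> {1}" "y \<notin> U"
      using sep by blast
    then have "f y = 1" using xy by blast
    then show False using fun_cong[OF xy(3), of f] f by simp
  qed
  show "open_map X (subtopology ?P (?j ` topspace X)) ?j"
    unfolding open_map_def
  proof (intro allI impI)
    fix U assume U: "openin X U"
    show "openin (subtopology ?P (?j ` topspace X)) (?j ` U)"
    proof (subst openin_subopen, intro ballI)
      fix y assume "y \<in> ?j ` U"
      then obtain x where x: "x \<in> U" "y = ?j x" by blast
      obtain f where f: "f \<in> I" "f x = 0" "f ` (topspace X - U) \<subseteq> {1}"
        using sep[OF U x(1)] by blast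
      \<comment> \<open>As \<open>f\<close> is 1 outside \<open>U\<close>, an evaluation whose
        coordinate \<open>f\<close> is below 1 comes from a point of \<open>U\<close>.\<close>
      let ?V = "{w \<in> topspace ?P. w f \<in> {..<1}}"
      have "openin ?P ?V"
        using f(1) by (intro openin_continuous_map_preimage[OF continuous_map_product_projection]) auto
      then have "openin (subtopology ?P (?j ` topspace X)) (?j ` topspace X \<inter> ?V)"
        by (rule openin_subtopology_Int2)
      moreover have "y \<in> ?j ` topspace X \<inter> ?V"
        using x f openin_subset[OF U] by auto
      moreover have "?j ` topspace X \<inter> ?V \<subseteq> ?j ` U"
        using f by fastforce
      ultimately show "\<exists>T. openin (subtopology ?P (?j ` topspace X)) T \<and> y \<in> T \<and> T \<subseteq> ?j ` U"
        by blast
    qed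
  qed
qed

text \<open>The image of the Tychonoff embedding is closed: each point \<open>z\<close> of its
  closure defines a real filter on \<open>X\<close>, and the evaluation at the limit of this filter
  is \<open>z\<close>.\<close>

lemma realcompact_if_real_filters_converge:
  assumes "Hausdorff_space X" "completely_regular_space X"
    and conv: "\<And>F. real_filter X F \<Longrightarrow> \<exists>p. limitin X (\<lambda>x. x) p F"
  shows "realcompact_space X"
proof -
  define I where "I = {f. continuous_map X euclideanreal f}"
  let ?P = "product_topology (\<lambda>_. euclideanreal) I"
  let ?j = "\<lambda>x. \<lambda>f\<in>I. f x :: real"
  have "z \<in> ?j ` topspace X" if z: "z \<in> ?P closure_of (?j ` topspace X)" for z
  proof -
    \<comment> \<open>The filter generated by the sets on which countably many functions take the
      values prescribed by \<open>z\<close>. Such sets are nonempty by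
      \<open>closure_of_evaluations_countable\<close>, and countable unions of index sets give
      countable completeness.\<close>
    define F where "F = Abs_filter (\<lambda>Q. \<exists>A. countable A \<and> A \<subseteq> I \<and>
      (\<forall>x\<in>topspace X. (\<forall>f\<in>A. f x = z f) \<longrightarrow> Q x))"
    have F: "eventually Q F \<longleftrightarrow> (\<exists>A. countable A \<and> A \<subseteq> I \<and>
      (\<forall>x\<in>topspace X. (\<forall>f\<in>A. f x = z f) \<longrightarrow> Q x))" for Q
      unfolding F_def
    proof (rule eventually_Abs_filter, standard, goal_cases)
      case 1 show ?case by (intro exI[of _ "{}"]) auto
    next
      case (2 P Q)
      then obtain A B where
        A: "countable A" "A \<subseteq> I" "\<forall>x\<in>topspace X. (\<forall>f\<in>A. f x = z f) \<longrightarrow> P x" and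
        B: "countable B" "B \<subseteq> I" "\<forall>x\<in>topspace X. (\<forall>f\<in>B. f x = z f) \<longrightarrow> Q x" by auto
      then show ?case by (intro exI[of _ "A \<union> B"]) auto
    next
      case (3 P Q)
      then show ?case by blast
    qed
    have "eventually (\<lambda>x. f x = z f) F" if "f \<in> I" for f
      unfolding F by (rule exI[of _ "{f}"]) (use that in auto)
    note evz = this
    have rf: "real_filter X F"
      unfolding real_filter_def
    proof (intro conjI)
      show "F \<noteq> bot"
        unfolding trivial_limit_def F
        using closure_of_evaluations_countable[OF z[unfolded I_def], folded I_def] by blast
      show "eventually (\<lambda>x. x \<in> topspace X) F"
        unfolding F by (rule exI[of _ "{}"]) auto
      show "\<forall>f. continuous_map X euclideanreal f \<longrightarrow> (\<exists>c. \<forall>\<^sub>F x in F. f x = c)"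
        using evz unfolding I_def by blast
      show "countably_complete F"
        unfolding countably_complete_def
      proof (intro allI impI)
        fix P :: "nat \<Rightarrow> 'a \<Rightarrow> bool" assume "\<forall>n. eventually (P n) F"
        then obtain A where A: "\<And>n. countable (A n)" "\<And>n. A n \<subseteq> I"
          "\<And>n. \<forall>x\<in>topspace X. (\<forall>f\<in>A n. f x = z f) \<longrightarrow> P n x"
          unfolding F by metis
        then show "eventually (\<lambda>x. \<forall>n. P n x) F"
          unfolding F by (intro exI[of _ "\<Union>n. A n"]) (auto; blast)
      qed
    qed
    then obtain p where p: "limitin X (\<lambda>x. x) p F"
      using conv by blast
    have "f p = z f" if f: "f \<in> I" for f
    proof -
      have "limitin euclideanreal (f \<circ> (\<lambda>x. x)) (f p) F"
        using f p unfolding I_def by (intro continuous_map_limit) auto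
      moreover have "limitin euclideanreal (f \<circ> (\<lambda>x. x)) (z f) F"
        using evz[OF f] by (intro limitin_eventually) (auto simp: o_def)
      ultimately show ?thesis
        using rf limitin_Hausdorff_unique unfolding real_filter_def
        by (metis Hausdorff_space_euclidean)
    qed
    moreover have "z \<in> extensional I"
      using z in_closure_of[of z ?P] by (auto simp: topspace_product_topology PiE_def)
    ultimately have "z = ?j p"
      by (auto simp: extensional_def fun_eq_iff)
    then show ?thesis
      using limitin_topspace[OF p] by blast
  qed
  moreover have "?j ` topspace X \<subseteq> topspace ?P"
    by auto
  ultimately have "closedin ?P (?j ` topspace X)"
    using closure_of_subset_eq by blast
  moreover have "X homeomorphic_space subtopology ?P (?j ` topspace X)"
    using evaluations_homeomorphic_map[OF assms(1,2)] unfolding I_def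
    by (rule homeomorphic_map_imp_homeomorphic_space)
  ultimately show ?thesis
    by (rule realcompact_spaceI)
qed

section \<open>Implications between the completeness properties\<close>

lemma realcompact_imp_Dieudonne_complete:
  "realcompact_space X \<Longrightarrow> Dieudonne_complete_space X"
  unfolding realcompact_space_def
  by (blast intro: Dieudonne_complete_spaceI[OF metrizable_space_euclidean])

lemma realcompact_space_homeomorphic:
  assumes "X homeomorphic_space Y" "realcompact_space Y"
  shows "realcompact_space X"
  using assms unfolding realcompact_space_def[of Y]
  by (blast intro: realcompact_spaceI homeomorphic_space_trans)

lemma realcompact_imp_locally_realcompact:
  assumes "realcompact_space X"
  shows "locally_realcompact_space X"
  unfolding locally_realcompact_space_def
  by (metis assms closure_of_topspace openin_topspace subtopology_topspace)

lemma Dieudonne_complete_imp_locally: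
  assumes "Dieudonne_complete_space X"
  shows "locally_Dieudonne_complete_space X"
  unfolding locally_Dieudonne_complete_space_def
  by (metis assms closure_of_topspace openin_topspace subtopology_topspace)

lemma locally_realcompact_imp_locally_Dieudonne:
  "locally_realcompact_space X \<Longrightarrow> locally_Dieudonne_complete_space X"
  unfolding locally_realcompact_space_def locally_Dieudonne_complete_space_def
  using realcompact_imp_Dieudonne_complete by blast

section \<open>Subspaces closed in the G_delta-topology\<close>

text \<open>Finite intersections of G_delta-sets are G_delta-sets, so these form a base and not
  merely a subbase of the topology they generate. Being closed can therefore be tested with one
  sequence of neighbourhoods per outside point.\<close>

lemma gdelta_closedin_iff:
  "gdelta_closedin X S \<longleftrightarrow> S \<subseteq> topspace X \<and>
     (\<forall>p\<in>topspace X - S. \<exists>W :: nat \<Rightarrow> 'a set.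
        (\<forall>n. openin X (W n) \<and> p \<in> W n) \<and> S \<inter> (\<Inter>n. W n) = {})"
    (is "_ \<longleftrightarrow> _ \<and> (\<forall>p\<in>_. ?N p)")
proof -
  have base: "\<exists>Q. gdelta_in X Q \<and> p \<in> Q \<and> Q \<subseteq> U"
    if "openin (gdelta_topology X) U" "p \<in> U" for p U
  proof -
    have "generate_topology_on {S. gdelta_in X S} U"
      using that(1) unfolding gdelta_topology_def openin_topology_generated_by_iff .
    then show ?thesis using that(2)
    proof (induction arbitrary: p rule: generate_topology_on.induct)
      case (Int a b)
      then show ?case by (metis IntE Int_mono gdelta_in_Int IntI)
    next
      case (UN K)
      then show ?case by (meson UnionE Union_upper subset_trans)
    qed auto
  qed
  have gd: "\<exists>W :: nat \<Rightarrow> 'a set. (\<forall>n. openin X (W n) \<and> p \<in> W n) \<and> (\<Inter>n. W n) = Q"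
    if Q: "gdelta_in X Q" "p \<in> Q" for Q p
  proof -
    obtain W :: "nat \<Rightarrow> 'a set" where W: "\<forall>n. openin X (W n)" "\<Inter>(range W) = Q"
      using Q(1) unfolding gdelta_in_descending by blast
    then show ?thesis using Q(2) by (intro exI[of _ W]) auto
  qed
  have dg: "gdelta_in X (\<Inter>n. W n)" if "\<And>n. openin X (W n)" for W :: "nat \<Rightarrow> 'a set"
    by (rule gdelta_in_Inter) (use that open_imp_gdelta_in in auto)
  have sub: "openin (gdelta_topology X) Q" if "gdelta_in X Q" for Q
    unfolding gdelta_topology_def openin_topology_generated_by_iff
    using that by (auto intro: generate_topology_on.Basis)
  show ?thesis
  proof
    assume S: "gdelta_closedin X S"
    then have sS: "S \<subseteq> topspace X" and op: "openin (gdelta_topology X) (topspace X - S)"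
      unfolding gdelta_closedin_def closedin_def topspace_gdelta_topology by auto
    have "?N p" if p: "p \<in> topspace X - S" for p
    proof -
      obtain Q where "gdelta_in X Q" "p \<in> Q" "Q \<subseteq> topspace X - S"
        using base[OF op p] by blast
      then show ?thesis using gd[of Q p] by blast
    qed
    with sS show "S \<subseteq> topspace X \<and> (\<forall>p\<in>topspace X - S. ?N p)" by blast
  next
    assume S: "S \<subseteq> topspace X \<and> (\<forall>p\<in>topspace X - S. ?N p)"
    have "openin (gdelta_topology X) (topspace X - S)"
    proof (subst openin_subopen, intro ballI)
      fix p assume p: "p \<in> topspace X - S"
      then obtain W :: "nat \<Rightarrow> 'a set" where
        W: "\<And>n. openin X (W n) \<and> p \<in> W n" "S \<inter> (\<Inter>n. W n) = {}" using S by blast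
      have "(\<Inter>n. W n) \<subseteq> topspace X"
        using W(1) openin_subset by blast
      then show "\<exists>U. openin (gdelta_topology X) U \<and> p \<in> U \<and> U \<subseteq> topspace X - S"
        using W by (intro exI[of _ "\<Inter>n. W n"]) (auto intro: sub dg)
    qed
    then show "gdelta_closedin X S"
      using S unfolding gdelta_closedin_def closedin_def topspace_gdelta_topology by blast
  qed
qed

text \<open>Continuous functions restrict to \<open>S\<close>, so a real filter on \<open>S\<close>
  is real on \<open>X\<close> and has a limit there. A limit outside \<open>S\<close> would have
  countably many neighbourhoods with no common point in \<open>S\<close>, against countable
  completeness.\<close>

lemma realcompact_gdelta_closedin:
  assumes X: "Hausdorff_space X" "completely_regular_space X" "realcompact_space X"
    and S: "gdelta_closedin X S"
  shows "realcompact_space (subtopology X S)"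
proof (rule realcompact_if_real_filters_converge)
  fix F assume F: "real_filter (subtopology X S) F"
  then have evS: "eventually (\<lambda>x. x \<in> S) F" and cc: "countably_complete F" and "F \<noteq> bot"
    unfolding real_filter_def by (auto elim: eventually_mono)
  have "real_filter X F"
    using F continuous_map_from_subtopology[of X euclideanreal] unfolding real_filter_def
    by (fastforce elim: eventually_mono)
  then obtain p where p: "limitin X (\<lambda>x. x) p F"
    using realcompact_imp_real_filter_converges[OF X(3)] by metis
  have "p \<in> S"
  proof (rule ccontr)
    assume "p \<notin> S"
    then obtain W :: "nat \<Rightarrow> 'a set" where
      W: "\<And>n. openin X (W n) \<and> p \<in> W n" "S \<inter> (\<Inter>n. W n) = {}"
      using S limitin_topspace[OF p] unfolding gdelta_closedin_iff by blast
    have "eventually (\<lambda>x. \<forall>n. x \<in> W n) F"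
      using p W(1) by (intro countably_completeD[OF cc]) (auto simp: limitin_def)
    with evS have "eventually (\<lambda>x. False) F"
      by eventually_elim (use W(2) in blast)
    then show False using \<open>F \<noteq> bot\<close> trivial_limit_def by blast
  qed
  then have "limitin (subtopology X S) (\<lambda>x. x) p F"
    using p evS by (simp add: limitin_subtopology)
  then show "\<exists>p. limitin (subtopology X S) (\<lambda>x. x) p F" ..
qed (use X Hausdorff_space_subtopology completely_regular_space_subtopology in auto)


section \<open>Countably complete ultrafilters and Ulam-measurable cardinals\<close>

text \<open>Principal ultrafilters are included; being non-principal is expressed where needed by
  avoiding every single point.\<close>

definition countably_complete_ultrafilter :: "'a filter \<Rightarrow> bool" where
  "countably_complete_ultrafilter F \<longleftrightarrow> F \<noteq> bot \<and> countably_complete F \<and>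
     (\<forall>P. eventually P F \<or> eventually (\<lambda>x. \<not> P x) F)"

text \<open>A point realising the same rational cuts as \<open>F\<close> has the value that \<open>f\<close> takes almost
  everywhere.\<close>

lemma countably_complete_ultrafilter_const:
  fixes f :: "'a \<Rightarrow> real"
  assumes F: "countably_complete_ultrafilter F"
  shows "\<exists>c. eventually (\<lambda>x. f x = c) F"
proof -
  define L where "L q \<longleftrightarrow> eventually (\<lambda>x. f x < q) F" for q :: real
  have cc: "countably_complete F"
    using F by (simp add: countably_complete_ultrafilter_def)
  have L: "eventually (\<lambda>x. f x < q \<longleftrightarrow> L q) F" for q
    using F unfolding countably_complete_ultrafilter_def L_def
    by (cases "eventually (\<lambda>x. f x < q) F") (auto elim: eventually_mono)
  have ev: "eventually (\<lambda>x. \<forall>q\<in>\<rat>. f x < q \<longleftrightarrow> L q) F"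
    using countable_rat L by (rule countably_complete_ball[OF cc])
  moreover have "F \<noteq> bot"
    using F by (simp add: countably_complete_ultrafilter_def)
  ultimately obtain a where a: "\<forall>q\<in>\<rat>. f a < q \<longleftrightarrow> L q"
    using eventually_happens' by blast
  have "f x = f a" if x: "\<forall>q\<in>\<rat>. f x < q \<longleftrightarrow> L q" for x
  proof (rule ccontr)
    assume "f x \<noteq> f a"
    then consider "f x < f a" | "f a < f x" by linarith
    then show False
      by cases (use Rats_dense_in_real a x in \<open>metis less_asym order.strict_trans\<close>)+
  qed
  then show ?thesis
    using ev by (intro exI[of _ "f a"]) (rule eventually_mono)
qed

lemma countably_complete_filtermap:
  "countably_complete F \<Longrightarrow> countably_complete (filtermap f F)"
  unfolding countably_complete_def by (simp add: eventually_filtermap)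

lemma countably_complete_ultrafilter_filtermap:
  "countably_complete_ultrafilter F \<Longrightarrow> countably_complete_ultrafilter (filtermap f F)"
  unfolding countably_complete_ultrafilter_def
  by (simp add: countably_complete_filtermap filtermap_bot_iff eventually_filtermap)

text \<open>The sets of measure 1 of a two-valued measure form the ultrafilter, namely its
  almost-everywhere filter; conversely the indicator of an ultrafilter is the measure.\<close>

lemma Ulam_measurable_iff:
  fixes \<kappa> :: "'c rel"
  shows "Ulam_measurable \<kappa> \<longleftrightarrow> (\<exists>F. countably_complete_ultrafilter F \<and>
     eventually (\<lambda>x. x \<in> Field \<kappa>) F \<and> (\<forall>x. eventually (\<lambda>y. y \<noteq> x) F))"
proof
  assume "Ulam_measurable \<kappa>"
  then obtain \<mu> :: "'c measure" where
    sp: "space \<mu> = Field \<kappa>" and st: "sets \<mu> = Pow (Field \<kappa>)" and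
    two: "\<And>A. A \<in> sets \<mu> \<Longrightarrow> emeasure \<mu> A \<in> {0, 1}" and
    at: "\<And>x. x \<in> Field \<kappa> \<Longrightarrow> emeasure \<mu> {x} = 0" and
    one: "emeasure \<mu> (Field \<kappa>) = 1"
    unfolding Ulam_measurable_def by auto
  have AE: "(AE x in \<mu>. P x) \<longleftrightarrow> emeasure \<mu> {x \<in> Field \<kappa>. \<not> P x} = 0" for P
    using AE_iff_measurable[of "{x \<in> Field \<kappa>. \<not> P x}" \<mu> P] st sp by auto
  have "countably_complete_ultrafilter (ae_filter \<mu>)"
    unfolding countably_complete_ultrafilter_def
  proof (intro conjI allI)
    show "ae_filter \<mu> \<noteq> bot"
      unfolding trivial_limit_def AE using one by simp
    show "countably_complete (ae_filter \<mu>)"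
      unfolding countably_complete_def AE_all_countable by blast
    fix P
    let ?A = "{x \<in> Field \<kappa>. P x}"
    have A: "?A \<in> sets \<mu>" using st by auto
    have "emeasure \<mu> {x \<in> Field \<kappa>. \<not> P x} = 0" if "emeasure \<mu> ?A = 1"
    proof -
      have "emeasure \<mu> (space \<mu> - ?A) = emeasure \<mu> (space \<mu>) - emeasure \<mu> ?A"
        by (rule emeasure_compl[OF A]) (simp add: that)
      moreover have "space \<mu> - ?A = {x \<in> Field \<kappa>. \<not> P x}"
        using sp by auto
      ultimately show ?thesis using one sp that by simp
    qed
    then show "(AE x in \<mu>. P x) \<or> (AE x in \<mu>. \<not> P x)"
      unfolding AE using two[OF A] by auto
  qed
  moreover have "AE x in \<mu>. x \<in> Field \<kappa>"
    using AE_space[of \<mu>] sp by simp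
  moreover have "AE y in \<mu>. y \<noteq> x" for x
  proof -
    have "{y \<in> Field \<kappa>. \<not> y \<noteq> x} = (if x \<in> Field \<kappa> then {x} else {})" by auto
    then show ?thesis unfolding AE using at[of x] by auto
  qed
  ultimately show "\<exists>F. countably_complete_ultrafilter F \<and>
      eventually (\<lambda>x. x \<in> Field \<kappa>) F \<and> (\<forall>x. eventually (\<lambda>y. y \<noteq> x) F)"
    by blast
next
  assume "\<exists>F. countably_complete_ultrafilter F \<and>
     eventually (\<lambda>x. x \<in> Field \<kappa>) F \<and> (\<forall>x. eventually (\<lambda>y. y \<noteq> x) F)"
  then obtain F where nb: "F \<noteq> bot" and cc: "countably_complete F" and
    ultra: "\<And>P. eventually P F \<or> eventually (\<lambda>x. \<not> P x) F" and
    ev: "eventually (\<lambda>x. x \<in> Field \<kappa>) F" and at: "\<And>x. eventually (\<lambda>y. y \<noteq> x) F"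
    unfolding countably_complete_ultrafilter_def by blast
  let ?\<mu> = "\<lambda>A. if eventually (\<lambda>x. x \<in> A) F then 1 else 0 :: ennreal"
  define M where "M = measure_of (Field \<kappa>) (Pow (Field \<kappa>)) ?\<mu>"
  have "countably_additive (Pow (Field \<kappa>)) ?\<mu>"
  proof (rule countably_additiveI)
    fix A :: "nat \<Rightarrow> 'c set" assume disj: "disjoint_family A"
    show "(\<Sum>i. ?\<mu> (A i)) = ?\<mu> (\<Union>i. A i)"
    \<comment> \<open>At most one member of a disjoint family belongs to the filter, so the series
      has at most one nonzero term. If no member belongs, all complements do, and countable
      completeness rules out the union.\<close>
    proof (cases "\<exists>k. eventually (\<lambda>x. x \<in> A k) F")
      case True
      then obtain k where k: "eventually (\<lambda>x. x \<in> A k) F" by blast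
      have "\<not> eventually (\<lambda>x. x \<in> A i) F" if "i \<noteq> k" for i
      proof
        assume "eventually (\<lambda>x. x \<in> A i) F"
        with k have "eventually (\<lambda>x. False) F"
          by eventually_elim (use disj that in \<open>auto simp: disjoint_family_on_def\<close>)
        then show False using nb by simp
      qed
      then have "(\<Sum>i. ?\<mu> (A i)) = (\<Sum>i. if i = k then 1 else 0)"
        by (intro arg_cong[where f = suminf]) (auto simp: k)
      also have "\<dots> = 1"
        using sums_single[of k "\<lambda>_. 1 :: ennreal"] by (simp add: sums_iff)
      finally show ?thesis
        using eventually_mono[OF k, of "\<lambda>x. x \<in> (\<Union>i. A i)"] by auto
    next
      case False
      then have "eventually (\<lambda>x. \<forall>i. x \<notin> A i) F"
        using ultra by (intro countably_completeD[OF cc]) blast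
      moreover have "\<not> eventually (\<lambda>x. x \<in> (\<Union>i. A i)) F"
      proof
        assume "eventually (\<lambda>x. x \<in> (\<Union>i. A i)) F"
        with calculation have "eventually (\<lambda>x. False) F"
          by eventually_elim auto
        then show False using nb by simp
      qed
      ultimately show ?thesis using False by simp
    qed
  qed
  then have em: "emeasure M A = ?\<mu> A" if "A \<subseteq> Field \<kappa>" for A
    unfolding M_def using that nb
    by (intro emeasure_measure_of_sigma) (auto simp: sigma_algebra_Pow positive_def)
  show "Ulam_measurable \<kappa>"
    unfolding Ulam_measurable_def
  proof (intro exI[of _ M] conjI ballI)
    show "space M = Field \<kappa>" by (simp add: M_def)
    show st: "sets M = Pow (Field \<kappa>)"
      by (simp add: M_def sigma_algebra.sets_measure_of_eq[OF sigma_algebra_Pow])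
    show "emeasure M A \<in> {0, 1}" if "A \<in> sets M" for A
      using that em[of A] st by auto
    show "emeasure M {x} = 0" if "x \<in> Field \<kappa>" for x
    proof -
      have "\<not> eventually (\<lambda>y. y \<in> {x}) F"
      proof
        assume "eventually (\<lambda>y. y \<in> {x}) F"
        with at[of x] have "eventually (\<lambda>x. False) F"
          by eventually_elim auto
        then show False using nb by simp
      qed
      then show ?thesis using em[of "{x}"] that by simp
    qed
    show "emeasure M (Field \<kappa>) = 1"
      using em[of "Field \<kappa>"] ev by simp
  qed
qed


section \<open>Limits at the \<open>G\<^sub>\<delta>\<close>-closure of a dense set\<close>

context topological_group
begin

lemma continuous_map_mult:
  assumes "continuous_map X T f" "continuous_map X T g"
  shows "continuous_map X T (\<lambda>x. f x \<otimes> g x)"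
  using continuous_map_compose[OF continuous_map_pairedI[OF assms] continuous_mult]
  by (simp add: o_def)

lemma continuous_map_const_mult:
  assumes "a \<in> carrier G"
  shows "continuous_map T T (\<lambda>x. a \<otimes> x)" "continuous_map T T (\<lambda>x. x \<otimes> a)"
  using assms by (auto intro!: continuous_map_mult simp: topspace_eq)

lemma openin_translate:
  assumes "openin T U" "a \<in> carrier G"
  shows "openin T {x \<in> carrier G. a \<otimes> x \<in> U}" "openin T {x \<in> carrier G. x \<otimes> a \<in> U}"
  using openin_continuous_map_preimage[OF continuous_map_const_mult(1) assms(1)]
    openin_continuous_map_preimage[OF continuous_map_const_mult(2) assms(1)] assms(2)
  by (auto simp: topspace_eq)

lemma symmetric_square_nhd:
  assumes "openin T U" "\<one> \<in> U"
  obtains V where "openin T V" "\<one> \<in> V" "\<And>x. x \<in> V \<Longrightarrow> inv x \<in> V"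
    "\<And>x y. x \<in> V \<Longrightarrow> y \<in> V \<Longrightarrow> x \<otimes> y \<in> U"
proof -
  have "openin (prod_topology T T) {z \<in> topspace (prod_topology T T). (\<lambda>(x, y). x \<otimes> y) z \<in> U}"
    by (rule openin_continuous_map_preimage[OF continuous_mult assms(1)])
  moreover have "(\<one>, \<one>) \<in> {z \<in> topspace (prod_topology T T). (\<lambda>(x, y). x \<otimes> y) z \<in> U}"
    using assms(2) by (simp add: topspace_eq)
  ultimately obtain A B where AB: "openin T A" "openin T B" "\<one> \<in> A" "\<one> \<in> B"
    "A \<times> B \<subseteq> {z \<in> topspace (prod_topology T T). (\<lambda>(x, y). x \<otimes> y) z \<in> U}"
    unfolding openin_prod_topology_alt by meson
  define V where "V = (A \<inter> B) \<inter> {x \<in> topspace T. inv x \<in> A \<inter> B}"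
  show ?thesis
  proof (rule that[of V])
    show "openin T V"
      unfolding V_def using AB
      by (intro openin_Int openin_continuous_map_preimage[OF continuous_inv]) auto
    show "\<one> \<in> V"
      using AB by (simp add: V_def topspace_eq)
    show "inv x \<in> V" if "x \<in> V" for x
      using that by (auto simp: V_def topspace_eq)
    show "x \<otimes> y \<in> U" if "x \<in> V" "y \<in> V" for x y
      using that AB(5) by (auto simp: V_def)
  qed
qed

lemma mult_inv_mult_cancel:
  assumes "a \<in> carrier G" "b \<in> carrier G" "c \<in> carrier G"
  shows "(a \<otimes> inv b) \<otimes> (b \<otimes> c) = a \<otimes> c"
proof -
  have "(a \<otimes> inv b) \<otimes> (b \<otimes> c) = a \<otimes> (inv b \<otimes> b) \<otimes> c"
    using assms by (simp only: m_assoc m_closed inv_closed)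
  then show ?thesis using assms by simp
qed

lemma dense_meets:
  assumes "T closure_of Y = topspace T" "openin T W" "w \<in> W"
  shows "\<exists>y\<in>Y. y \<in> W"
  using assms openin_subset[OF assms(2)] in_closure_of by (metis subsetD)

end

text \<open>The closures of the tails along \<open>J\<close> have the finite intersection property.
  A general infinite index set \<open>J\<close> permits passing to a subsequence of bad
  indices.\<close>

lemma compactin_cluster_point:
  assumes K: "compactin X K" and x: "\<And>n. n \<in> J \<Longrightarrow> x n \<in> K" and J: "infinite (J :: nat set)"
  obtains y where "y \<in> K" "\<And>W m. openin X W \<Longrightarrow> y \<in> W \<Longrightarrow> \<exists>k\<in>J. m \<le> k \<and> x k \<in> W"
proof -
  define C where "C m = X closure_of (x ` {k \<in> J. m \<le> k})" for m
  have KX: "K \<subseteq> topspace X"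
    using K compactin_subset_topspace by blast
  have "K \<inter> \<Inter>\<F> \<noteq> {}" if F: "finite \<F>" "\<F> \<subseteq> range C" for \<F>
  proof -
    obtain A where A: "finite A" "\<F> = C ` A"
      using F finite_subset_image[OF F] by blast
    then obtain N where N: "A \<subseteq> {..N}"
      using finite_nat_iff_bounded_le by blast
    obtain k where k: "k \<in> J" "N \<le> k"
      using J by (meson infinite_nat_iff_unbounded_le)
    have "x k \<in> C m" if "m \<in> A" for m
      unfolding C_def
    proof (rule subsetD[OF closure_of_subset])
      show "x ` {k \<in> J. m \<le> k} \<subseteq> topspace X"
        using x KX by blast
      show "x k \<in> x ` {k \<in> J. m \<le> k}"
        using k N that by fastforce
    qed
    then show ?thesis using x[OF k(1)] A(2) by blast
  qed
  moreover have "\<forall>D\<in>range C. closedin X D"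
    by (auto simp: C_def)
  ultimately have "K \<inter> \<Inter>(range C) \<noteq> {}"
    using K unfolding compactin_fip by meson
  then obtain y where y: "y \<in> K" "\<And>m. y \<in> C m" by blast
  show ?thesis
  proof (rule that[OF y(1)])
    fix W m assume "openin X W" "y \<in> W"
    then show "\<exists>k\<in>J. m \<le> k \<and> x k \<in> W"
      using y(2)[of m] unfolding C_def in_closure_of by blast
  qed
qed

lemma (in Metric_space) continuous_map_mtopology_nhd:
  assumes f: "continuous_map X mtopology f" and x: "x \<in> topspace X" and e: "e > 0"
  obtains W where "openin X W" "x \<in> W" "\<And>y. y \<in> W \<Longrightarrow> d (f x) (f y) < e"
proof (rule that)
  have fx: "f x \<in> M"
    using continuous_map_image_subset_topspace[OF f] x by auto
  show "openin X {y \<in> topspace X. f y \<in> mball (f x) e}"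
    by (rule openin_continuous_map_preimage[OF f openin_mball])
  show "x \<in> {y \<in> topspace X. f y \<in> mball (f x) e}"
    using fx x e by simp
qed simp

text \<open>The subgroup \<open>N = (\<Inter>n. V n)\<close> constructed in the proof is so small that the
  \<open>G\<^sub>\<delta>\<close>-set \<open>N \<otimes> p\<close> decides the limit: it contains a cluster point of each of the two
  sequences of almost maximal oscillation, and translating by \<open>N\<close> moves that cluster point to a
  point \<open>g\<close> of \<open>Y\<close> without changing the limit of \<open>f\<close> along the sequence.\<close>

lemma (in topological_group) limit_at_gdelta_closure:
  assumes lc: "locally_compact_space T"
    and Y: "Y \<subseteq> carrier G" "T closure_of Y = topspace T"
    and p: "p \<in> A" "openin T A"
    and gd: "\<And>W :: nat \<Rightarrow> 'a set. (\<And>n. openin T (W n) \<and> p \<in> W n) \<Longrightarrow> \<exists>y\<in>Y. \<forall>n. y \<in> W n"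
    and M: "metrizable_space M"
    and f: "continuous_map (subtopology T (Y \<inter> A)) M f"
  shows "\<exists>m. limitin M f m (inf (nhdsin T p) (principal (Y \<inter> A)))"
proof -
  obtain S d where MS: "Metric_space S d" "M = Metric_space.mtopology S d"
    using M unfolding metrizable_space_def by blast
  interpret M: Metric_space S d by fact
  have AG: "A \<subseteq> carrier G"
    using p(2) openin_subset topspace_eq by blast
  have pG: "p \<in> carrier G" using p(1) AG by blast
  have f: "continuous_map (subtopology T (Y \<inter> A)) M.mtopology f"
    using f MS(2) by simp
  have fS: "f y \<in> S" if "y \<in> Y \<inter> A" for y
    using continuous_map_image_subset_topspace[OF f] that Y(1) by (auto simp: topspace_eq)
  \<comment> \<open>The compact neighbourhood \<open>K\<close> of \<open>p\<close> will contain the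
    sequences below and so provide their cluster points.\<close>
  obtain U K where UK: "openin T U" "compactin T K" "p \<in> U" "U \<subseteq> K"
    using lc pG unfolding locally_compact_space_def topspace_eq by blast
  define B where "B V = {y \<in> Y \<inter> A. y \<otimes> inv p \<in> V}" for V
  have BG: "B V \<subseteq> carrier G" for V
    using Y(1) by (auto simp: B_def)
  \<comment> \<open>Continuity of \<open>f\<close> at \<open>x\<close>, expressed by a right
    translate of a neighbourhood of the identity.\<close>
  have nhd: "\<exists>V. openin T V \<and> \<one> \<in> V \<and> (\<forall>y\<in>Y \<inter> A. y \<otimes> inv x \<in> V \<longrightarrow> d (f x) (f y) < e)"
    if x: "x \<in> Y \<inter> A" and e: "e > 0" for x e
  proof -
    have xG: "x \<in> carrier G" using x Y(1) by blast
    obtain W where W: "openin (subtopology T (Y \<inter> A)) W" "x \<in> W"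
      "\<And>y. y \<in> W \<Longrightarrow> d (f x) (f y) < e"
      using M.continuous_map_mtopology_nhd[OF f _ e, of x] x xG by (auto simp: topspace_eq)
    then obtain W' where W': "openin T W'" "W = W' \<inter> (Y \<inter> A)"
      unfolding openin_subtopology by blast
    have "v \<in> W'" if "v \<in> Y \<inter> A" "v \<otimes> inv x \<otimes> x \<in> W'" for v
      using that Y(1) xG by (auto simp: m_assoc)
    then show ?thesis
      using W W' xG openin_translate(2)[OF W'(1) xG]
      by (intro exI[of _ "{v \<in> carrier G. v \<otimes> x \<in> W'}"]) auto
  qed
  \<comment> \<open>A pair that almost realises the oscillation of \<open>f\<close> on
    \<open>B V\<close>. The cap 1 makes the supremum finite, and the factor 2 leaves room to choose
    a pair above half of it; if the supremum is not positive, \<open>f\<close> is constant on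
    \<open>B V\<close> and any point serves twice.\<close>
  have "\<exists>x x'. x \<in> B V \<and> x' \<in> B V \<and>
      (\<forall>z\<in>B V. \<forall>z'\<in>B V. min 1 (d (f z) (f z')) \<le> 2 * d (f x) (f x'))"
    if V: "openin T V" "\<one> \<in> V" for V
  proof -
    have "openin T (A \<inter> {y \<in> carrier G. y \<otimes> inv p \<in> V})"
      using V pG p by (intro openin_Int openin_translate) auto
    moreover have "p \<in> A \<inter> {y \<in> carrier G. y \<otimes> inv p \<in> V}"
      using V pG p by simp
    ultimately obtain y where y: "y \<in> B V"
      using dense_meets[OF Y(2)] unfolding B_def by blast
    define D where "D = (\<lambda>(z, z'). min 1 (d (f z) (f z'))) ` (B V \<times> B V)"
    have bdd: "bdd_above D"
      unfolding D_def by (intro bdd_aboveI[of _ 1]) auto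
    have ub: "min 1 (d (f z) (f z')) \<le> Sup D" if "z \<in> B V" "z' \<in> B V" for z z'
      using that by (intro cSup_upper[OF _ bdd]) (auto simp: D_def)
    show ?thesis
    proof (cases "Sup D \<le> 0")
      case True
      have "min 1 (d (f z) (f z')) \<le> 2 * d (f y) (f y)" if "z \<in> B V" "z' \<in> B V" for z z'
        using ub[OF that] True M.nonneg[of "f y" "f y"] by linarith
      then show ?thesis using y by blast
    next
      case False
      have "D \<noteq> {}" using y by (auto simp: D_def)
      then obtain s where "s \<in> D" "Sup D / 2 < s"
        using less_cSup_iff[OF _ bdd, of "Sup D / 2"] False by (auto simp: not_le)
      moreover then obtain x x' where x: "x \<in> B V" "x' \<in> B V" "s = min 1 (d (f x) (f x'))"
        unfolding D_def by auto
      ultimately have "Sup D \<le> 2 * d (f x) (f x')" by linarith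
      then show ?thesis
        using ub x by (meson order_trans)
    qed
  qed
  then obtain a a' where aB: "\<And>V. openin T V \<Longrightarrow> \<one> \<in> V \<Longrightarrow> a V \<in> B V"
    and a'B: "\<And>V. openin T V \<Longrightarrow> \<one> \<in> V \<Longrightarrow> a' V \<in> B V"
    and osc: "\<And>V z z'. openin T V \<Longrightarrow> \<one> \<in> V \<Longrightarrow> z \<in> B V \<Longrightarrow> z' \<in> B V \<Longrightarrow>
      min 1 (d (f z) (f z')) \<le> 2 * d (f (a V)) (f (a' V))"
    by metis
  define small where "small V x n \<longleftrightarrow>
    (\<forall>y\<in>Y \<inter> A. y \<otimes> inv x \<in> V \<longrightarrow> d (f x) (f y) < 1 / real (Suc n))" for V x n
  \<comment> \<open>The last condition keeps the translate of \<open>V\<close> by \<open>p\<close>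
    inside \<open>A\<close>, where \<open>f\<close> is considered, and inside \<open>U\<close>,
    hence inside \<open>K\<close>.\<close>
  define good where "good V \<longleftrightarrow> openin T V \<and> \<one> \<in> V \<and> (\<forall>v\<in>V. inv v \<in> V) \<and>
    (\<forall>y\<in>carrier G. y \<otimes> inv p \<in> V \<longrightarrow> y \<in> A \<inter> U)" for V
  \<comment> \<open>Squares shrink so that the intersection of all \<open>V n\<close> is a subgroup.
    Smallness of \<open>V (Suc n)\<close> refers to the pair already chosen for \<open>V n\<close>,
    so translating these points by the subgroup hardly affects nearby values of
    \<open>f\<close>.\<close>
  have "\<exists>V. \<forall>n. good (V n) \<and> ((\<forall>u\<in>V (Suc n). \<forall>v\<in>V (Suc n). u \<otimes> v \<in> V n) \<and>
      small (V (Suc n)) (a (V n)) n \<and> small (V (Suc n)) (a' (V n)) n)"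
  proof (rule dependent_nat_choice)
    have "openin T {v \<in> carrier G. v \<otimes> p \<in> A \<inter> U}" "\<one> \<in> {v \<in> carrier G. v \<otimes> p \<in> A \<inter> U}"
      using openin_translate(2)[OF openin_Int[OF p(2) UK(1)] pG] p UK pG by auto
    then obtain V where V: "openin T V" "\<one> \<in> V" "\<And>x. x \<in> V \<Longrightarrow> inv x \<in> V"
      "\<And>x y. x \<in> V \<Longrightarrow> y \<in> V \<Longrightarrow> x \<otimes> y \<in> {v \<in> carrier G. v \<otimes> p \<in> A \<inter> U}"
      using symmetric_square_nhd by blast
    have "y \<in> A \<inter> U" if "y \<in> carrier G" "y \<otimes> inv p \<in> V" for y
      using V(4)[OF that(2) V(2)] that(1) pG by (simp add: m_assoc)
    then show "\<exists>V. good V"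
      using V unfolding good_def by blast
  next
    fix V and n :: nat assume V: "good V"
    then have op: "openin T V" "\<one> \<in> V" by (auto simp: good_def)
    obtain V1 where V1: "openin T V1" "\<one> \<in> V1" "small V1 (a V) n"
      using nhd[of "a V" "1 / real (Suc n)"] aB[OF op] unfolding small_def B_def by auto
    obtain V2 where V2: "openin T V2" "\<one> \<in> V2" "small V2 (a' V) n"
      using nhd[of "a' V" "1 / real (Suc n)"] a'B[OF op] unfolding small_def B_def by auto
    have "openin T (V \<inter> V1 \<inter> V2)" "\<one> \<in> V \<inter> V1 \<inter> V2"
      using op V1 V2 by auto
    then obtain V' where V': "openin T V'" "\<one> \<in> V'" "\<And>x. x \<in> V' \<Longrightarrow> inv x \<in> V'"
      "\<And>x y. x \<in> V' \<Longrightarrow> y \<in> V' \<Longrightarrow> x \<otimes> y \<in> V \<inter> V1 \<inter> V2"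
      using symmetric_square_nhd by blast
    have sub: "v \<in> V \<inter> V1 \<inter> V2" if "v \<in> V'" for v
      using V'(4)[OF that V'(2)] openin_subset[OF V'(1)] that by (auto simp: topspace_eq)
    then show "\<exists>V'. good V' \<and> ((\<forall>u\<in>V'. \<forall>v\<in>V'. u \<otimes> v \<in> V) \<and>
      small V' (a V) n \<and> small V' (a' V) n)"
      using V V' V1(3) V2(3) unfolding good_def small_def
      by (intro exI[of _ V']) blast
  qed
  then obtain V where good: "\<And>n. good (V n)"
    and sq: "\<And>n u v. u \<in> V (Suc n) \<Longrightarrow> v \<in> V (Suc n) \<Longrightarrow> u \<otimes> v \<in> V n"
    and sm: "\<And>n. small (V (Suc n)) (a (V n)) n" "\<And>n. small (V (Suc n)) (a' (V n)) n"
    by blast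
  have op: "openin T (V n)" "\<one> \<in> V n" and VG: "V n \<subseteq> carrier G"
    and sym: "\<And>v. v \<in> V n \<Longrightarrow> inv v \<in> V n"
    and VA: "\<And>y. y \<in> carrier G \<Longrightarrow> y \<otimes> inv p \<in> V n \<Longrightarrow> y \<in> A \<inter> U" for n
    using good[of n] openin_subset[of T "V n"] unfolding good_def topspace_eq by auto
  have "V (Suc n) \<subseteq> V n" for n
    using sq[of _ n \<one>] op(2) VG by fastforce
  then have Vmono: "V n \<subseteq> V m" if "m \<le> n" for m n
    using that lift_Suc_antimono_le[of V] by blast
  \<comment> \<open>The translates of the \<open>V n\<close> by \<open>p\<close> are countably many
    neighbourhoods of \<open>p\<close>, so the hypothesis \<open>gd\<close> yields a point
    \<open>g\<close> of \<open>Y\<close> common to all of them. The limit will be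
    \<open>f g\<close>.\<close>
  have "\<exists>y\<in>Y. \<forall>n. y \<in> {y \<in> carrier G. y \<otimes> inv p \<in> V n}"
    using openin_translate(2)[OF op(1)] op(2) pG by (intro gd) auto
  then obtain g where g: "g \<in> Y" "g \<in> carrier G" "\<And>n. g \<otimes> inv p \<in> V n" by blast
  then have gA: "g \<in> Y \<inter> A" using VA by blast
  \<comment> \<open>It suffices that each \<open>x n\<close> is close to \<open>p\<close> and that
    \<open>V (Suc n)\<close> is small for it, so this applies to both members of the almost maximal
    pairs. The bad indices \<open>J\<close> are refuted at a cluster point \<open>y\<close>.\<close>
  have key: "\<exists>N. \<forall>n\<ge>N. d (f (x n)) (f g) < e"
    if x: "\<And>n. x n \<in> B (V n)" "\<And>n. small (V (Suc n)) (x n) n" and e: "e > 0" for x e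
  proof (rule ccontr)
    assume no: "\<not> ?thesis"
    define J where "J = {n. \<not> d (f (x n)) (f g) < e}"
    have J: "infinite J"
      using no unfolding infinite_nat_iff_unbounded_le J_def by blast
    have xG: "x n \<in> carrier G" and xp: "x n \<otimes> inv p \<in> V n" and xYA: "x n \<in> Y \<inter> A" for n
      using x(1)[of n] Y(1) unfolding B_def by auto
    have "x n \<in> K" for n
      using VA[OF xG xp] UK(4) by blast
    then obtain y where y: "y \<in> K"
      and cl: "\<And>W m. openin T W \<Longrightarrow> y \<in> W \<Longrightarrow> \<exists>k\<in>J. m \<le> k \<and> x k \<in> W"
      using compactin_cluster_point[OF UK(2) _ J, of x] by blast
    have yG: "y \<in> carrier G"
      using y UK(2) compactin_subset_topspace topspace_eq by blast
    \<comment> \<open>Some late \<open>x k\<close> is close to \<open>y\<close> as well as to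
      \<open>p\<close>; the quotient of the two differences places \<open>y\<close> in the translate
      of \<open>V n\<close>.\<close>
    have yp: "y \<otimes> inv p \<in> V n" for n
    proof -
      obtain k where k: "Suc n \<le> k" "x k \<otimes> inv y \<in> V (Suc n)"
        using cl[OF openin_translate(2)[OF op(1)[of "Suc n"], of "inv y"], of "Suc n"] yG op(2)
        by auto
      have "inv (x k \<otimes> inv y) \<in> V (Suc n)" "x k \<otimes> inv p \<in> V (Suc n)"
        using sym[OF k(2)] xp[of k] Vmono[OF k(1)] by auto
      then have "inv (x k \<otimes> inv y) \<otimes> (x k \<otimes> inv p) \<in> V n"
        by (rule sq)
      then show ?thesis
        using xG yG pG by (simp add: inv_mult_group mult_inv_mult_cancel)
    qed
    \<comment> \<open>Both \<open>g\<close> and \<open>y\<close> lie in the translate by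
      \<open>p\<close> of the intersection of the \<open>V n\<close>, so \<open>c\<close> lies in
      that intersection, and it carries \<open>y\<close> to \<open>g\<close>.\<close>
    define c where "c = g \<otimes> inv y"
    have cG: "c \<in> carrier G" using g yG by (simp add: c_def)
    have cV: "c \<in> V n" for n
    proof -
      have "(g \<otimes> inv p) \<otimes> inv (y \<otimes> inv p) \<in> V n"
        by (rule sq[OF g(3) sym[OF yp]])
      then show ?thesis
        using g yG pG by (simp add: inv_mult_group mult_inv_mult_cancel c_def)
    qed
    have cy: "c \<otimes> y = g"
      using g yG by (simp add: c_def m_assoc)
    obtain W where W: "openin (subtopology T (Y \<inter> A)) W" "g \<in> W"
      "\<And>z. z \<in> W \<Longrightarrow> d (f g) (f z) < e / 2"
      using M.continuous_map_mtopology_nhd[OF f, of g "e / 2"] gA g(2) e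
      by (auto simp: topspace_eq)
    then obtain W' where W': "openin T W'" "W = W' \<inter> (Y \<inter> A)"
      unfolding openin_subtopology by blast
    have W'A: "openin T (W' \<inter> A)" "g \<in> W' \<inter> A"
      using W' W(2) p(2) by auto
    obtain m where m: "1 / real (Suc m) < e / 2"
      using e nat_approx_posE[of "e / 2"] by auto
    obtain k where k: "k \<in> J" "m \<le> k" "c \<otimes> x k \<in> W' \<inter> A"
      using cl[OF openin_translate(1)[OF W'A(1) cG], of m] cy W'A(2) yG by auto
    \<comment> \<open>The point \<open>c \<otimes> x k\<close> may lie outside \<open>Y\<close>,
      where \<open>f\<close> is not controlled. Density replaces it by \<open>z\<close> in
      \<open>Y\<close>, close enough to \<open>x k\<close> for smallness and to \<open>g\<close> for
      continuity.\<close>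
    have "openin T ({h \<in> carrier G. h \<otimes> inv (x k) \<in> V (Suc k)} \<inter> (W' \<inter> A))"
      using openin_translate(2)[OF op(1), of "inv (x k)"] W'A(1) xG by auto
    moreover have "c \<otimes> x k \<in> {h \<in> carrier G. h \<otimes> inv (x k) \<in> V (Suc k)} \<inter> (W' \<inter> A)"
      using k(3) cV xG cG by (simp add: m_assoc)
    ultimately obtain z where z: "z \<in> Y" "z \<otimes> inv (x k) \<in> V (Suc k)" "z \<in> W' \<inter> A"
      using dense_meets[OF Y(2)] by blast
    have "d (f (x k)) (f z) < 1 / real (Suc k)"
      using x(2)[of k] z unfolding small_def by blast
    also have "\<dots> \<le> 1 / real (Suc m)"
      using k(2) by (simp add: frac_le)
    also note m
    finally have "d (f (x k)) (f z) < e / 2" .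
    moreover have "d (f g) (f z) < e / 2"
      using W(3) W'(2) z by blast
    moreover have "d (f (x k)) (f g) \<le> d (f (x k)) (f z) + d (f z) (f g)"
      using fS xYA gA z by (intro M.triangle) auto
    ultimately have "d (f (x k)) (f g) < e"
      using M.commute[of "f z" "f g"] by linarith
    then show False using k(1) unfolding J_def by blast
  qed
  have "limitin M.mtopology f (f g) (inf (nhdsin T p) (principal (Y \<inter> A)))"
    unfolding M.limitin_metric
  proof (intro conjI allI impI)
    show "f g \<in> S" by (rule fS[OF gA])
    fix e :: real assume "e > 0"
    \<comment> \<open>With this \<open>r\<close> the oscillation bound \<open>4 * r\<close> stays
      below the cap 1, so it bounds the true distance, and the total error \<open>4 * r + r\<close>
      is at most \<open>e\<close>.\<close>
    define r where "r = min 1 e / 8"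
    have r: "r > 0" "5 * r \<le> e" "4 * r \<le> 1"
      using \<open>e > 0\<close> by (auto simp: r_def)
    obtain n where n: "d (f (a (V n))) (f g) < r" "d (f (a' (V n))) (f g) < r"
      using key[of "\<lambda>n. a (V n)" r] key[of "\<lambda>n. a' (V n)" r] aB a'B op sm r(1)
      by (metis max.cobounded1 max.cobounded2)
    let ?x = "a (V n)" and ?x' = "a' (V n)"
    have xx: "?x \<in> Y \<inter> A" "?x' \<in> Y \<inter> A" "?x \<in> B (V n)"
      using aB[OF op] a'B[OF op] unfolding B_def by auto
    have "d (f ?x) (f ?x') \<le> d (f ?x) (f g) + d (f g) (f ?x')"
      using fS xx gA by (intro M.triangle) auto
    then have osc_small: "2 * d (f ?x) (f ?x') < 4 * r"
      using n M.commute[of "f g" "f ?x'"] by linarith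
    have small_d: "d (f z) (f g) < e" if z: "z \<in> Y \<inter> A" "z \<otimes> inv p \<in> V n" for z
    proof -
      have "min 1 (d (f z) (f ?x)) \<le> 2 * d (f ?x) (f ?x')"
        using osc[OF op] z xx(3) unfolding B_def by blast
      then have "d (f z) (f ?x) < 4 * r"
        using osc_small r(3) by linarith
      moreover have "d (f z) (f g) \<le> d (f z) (f ?x) + d (f ?x) (f g)"
        using fS xx gA z by (intro M.triangle) auto
      ultimately show ?thesis using n r(1,2) by linarith
    qed
    have "eventually (\<lambda>z. z \<in> {h \<in> carrier G. h \<otimes> inv p \<in> V n}) (nhdsin T p)"
      unfolding eventually_nhdsin
      using openin_translate(2)[OF op(1), of "inv p"] op(2) pG
      by (intro disjI2 exI[of _ "{h \<in> carrier G. h \<otimes> inv p \<in> V n}"]) auto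
    then show "\<forall>\<^sub>F z in inf (nhdsin T p) (principal (Y \<inter> A)). f z \<in> S \<and> d (f z) (f g) < e"
      unfolding eventually_inf_principal
      by (rule eventually_mono) (use fS small_d in auto)
  qed
  then show ?thesis using MS(2) by blast
qed


section \<open>Cosets of an open subgroup\<close>

context topological_group
begin

text \<open>The subgroup generated by a compact neighbourhood of the identity: it is the union of
  the iterated products of a compact symmetric set, and it is open because it contains a
  neighbourhood of the identity.\<close>

lemma open_sigma_compact_subgroup:
  assumes "locally_compact_space T"
  obtains L :: "'a set" and K :: "nat \<Rightarrow> 'a set" where
    "subgroup L G" "openin T L" "L = (\<Union>n. K n)" "\<And>n. compactin T (K n)"
proof -
  obtain U C where UC: "openin T U" "compactin T C" "\<one> \<in> U" "U \<subseteq> C"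
    using assms unfolding locally_compact_space_def topspace_eq by blast
  \<comment> \<open>Start with the symmetrised compact set and multiply each stage by itself; stage
    \<open>n\<close> consists of the products of \<open>2 ^ n\<close> factors.\<close>
  define K where "K = rec_nat (C \<union> (\<lambda>x. inv x) ` C) (\<lambda>_ A. (\<lambda>(x, y). x \<otimes> y) ` (A \<times> A))"
  have K0: "K 0 = C \<union> (\<lambda>x. inv x) ` C"
    and KS: "K (Suc n) = (\<lambda>(x, y). x \<otimes> y) ` (K n \<times> K n)" for n
    by (auto simp: K_def)
  have comp: "compactin T (K n)" for n
  proof (induction n)
    case 0
    show ?case
      unfolding K0 using UC(2) by (intro compactin_Un image_compactin[OF _ continuous_inv])
  next
    case (Suc n)
    then show ?case
      unfolding KS by (intro image_compactin[OF _ continuous_mult]) (simp add: compactin_Times)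
  qed
  then have KG: "K n \<subseteq> carrier G" for n
    using compactin_subset_topspace topspace_eq by blast
  have one: "\<one> \<in> K n" for n
  proof (induction n)
    case 0 show ?case using UC unfolding K0 by blast
  next
    case (Suc n)
    then show ?case unfolding KS by (auto intro!: image_eqI[of _ _ "(\<one>, \<one>)"])
  qed
  have "K n \<subseteq> K (Suc n)" for n
  proof
    fix x assume "x \<in> K n"
    then show "x \<in> K (Suc n)"
      unfolding KS using one[of n] KG[of n] by (auto intro!: image_eqI[of _ _ "(x, \<one>)"])
  qed
  then have mono: "K m \<subseteq> K n" if "m \<le> n" for m n
    using that lift_Suc_mono_le[of K] by blast
  have invK: "x \<in> K n \<Longrightarrow> inv x \<in> K n" for x n
  proof (induction n arbitrary: x)
    case 0
    then show ?case
      using UC(2) compactin_subset_topspace[of T C] unfolding K0 topspace_eq by auto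
  next
    case (Suc n)
    then obtain a b where ab: "a \<in> K n" "b \<in> K n" "x = a \<otimes> b"
      unfolding KS by auto
    then have "inv x = inv b \<otimes> inv a"
      using subsetD[OF KG] by (simp add: inv_mult_group)
    then show ?case
      unfolding KS using Suc.IH ab by (auto intro!: image_eqI[of _ _ "(inv b, inv a)"])
  qed
  have mulK: "x \<otimes> y \<in> (\<Union>n. K n)" if "x \<in> K m" "y \<in> K n" for x y m n
  proof -
    have "x \<in> K (max m n)" "y \<in> K (max m n)"
      using that mono[of m "max m n"] mono[of n "max m n"] by auto
    then have "x \<otimes> y \<in> K (Suc (max m n))"
      unfolding KS by force
    then show ?thesis by blast
  qed
  have sg: "subgroup (\<Union>n. K n) G"
  proof (rule subgroupI)
    show "(\<Union>n. K n) \<subseteq> carrier G" "(\<Union>n. K n) \<noteq> {}"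
      using KG one[of 0] by blast+
  qed (use invK mulK in auto)
  have "openin T (\<Union>n. K n)"
  proof (subst openin_subopen, intro ballI)
    fix x assume x: "x \<in> (\<Union>n. K n)"
    then have xG: "x \<in> carrier G" using KG by blast
    let ?W = "{y \<in> carrier G. inv x \<otimes> y \<in> U}"
    have "y \<in> (\<Union>n. K n)" if "y \<in> ?W" for y
    proof -
      have "inv x \<otimes> y \<in> K 0" using that UC unfolding K0 by blast
      then have "x \<otimes> (inv x \<otimes> y) \<in> (\<Union>n. K n)" using x mulK by blast
      then show ?thesis using that xG by (simp add: m_assoc[symmetric])
    qed
    moreover have "openin T ?W" "x \<in> ?W"
      using UC xG openin_translate(1)[OF UC(1)] by auto
    ultimately show "\<exists>W. openin T W \<and> x \<in> W \<and> W \<subseteq> (\<Union>n. K n)" by blast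
  qed
  then show ?thesis using that sg comp by blast
qed

lemma l_coset_eq_iff:
  assumes "subgroup L G" "x \<in> carrier G" "y \<in> carrier G"
  shows "x <# L = y <# L \<longleftrightarrow> inv x \<otimes> y \<in> L"
proof
  assume "x <# L = y <# L"
  moreover have "y \<in> y <# L"
    using subgroup.one_closed[OF assms(1)] assms(3) unfolding l_coset_def by force
  ultimately obtain l where l: "l \<in> L" "y = x \<otimes> l"
    unfolding l_coset_def by auto
  then show "inv x \<otimes> y \<in> L"
    using assms subgroup.mem_carrier[OF assms(1)] by (simp add: m_assoc[symmetric])
next
  assume "inv x \<otimes> y \<in> L"
  then have "y \<in> x <# L"
    using assms subgroup.lcos_module_rev[OF assms(1)] is_group by blast
  then show "x <# L = y <# L"
    using assms by (intro l_repr_independence)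
qed

lemma openin_coset_fibre:
  assumes "subgroup L G" "openin T L" "x \<in> carrier G"
  shows "openin T {y \<in> carrier G. y <# L = x <# L}"
proof -
  have "{y \<in> carrier G. y <# L = x <# L} = {y \<in> carrier G. inv x \<otimes> y \<in> L}"
    using l_coset_eq_iff[OF assms(1,3)] by metis
  then show ?thesis using openin_translate(1)[OF assms(2)] assms(3) by simp
qed

text \<open>The cosets are open, so a function of the coset is locally constant, whatever
  \<open>f\<close> is.\<close>

lemma continuous_map_coset:
  fixes f :: "'a set \<Rightarrow> real"
  assumes "subgroup L G" "openin T L"
  shows "continuous_map T euclideanreal (\<lambda>x. f (x <# L))"
  unfolding continuous_map
proof (intro conjI allI impI)
  fix U
  show "openin T {x \<in> topspace T. f (x <# L) \<in> U}"
  proof (subst openin_subopen, intro ballI)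
    fix x assume "x \<in> {x \<in> topspace T. f (x <# L) \<in> U}"
    then show "\<exists>W. openin T W \<and> x \<in> W \<and> W \<subseteq> {x \<in> topspace T. f (x <# L) \<in> U}"
      using openin_coset_fibre[OF assms, of x]
      by (intro exI[of _ "{y \<in> carrier G. y <# L = x <# L}"]) (auto simp: topspace_eq)
  qed
qed auto

text \<open>Functions of cosets are continuous, so a real filter induces a countably complete ultrafilter
  on the set of cosets. If the latter is principal, the filter lives on a single coset, which is
  \<open>\<sigma>\<close>-compact.\<close>

lemma realcompact_if_cosets_nonmeasurable:
  assumes L: "subgroup L G" "openin T L" "L = (\<Union>n. K n)" and K: "\<And>n :: nat. compactin T (K n)"
    and principal: "\<And>F. countably_complete_ultrafilter F \<Longrightarrow>
      eventually (\<lambda>c. c \<in> (\<lambda>x. x <# L) ` carrier G) F \<Longrightarrow> \<exists>c. \<not> eventually (\<lambda>d. d \<noteq> c) F"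
  shows "realcompact_space T"
proof (rule realcompact_if_real_filters_converge[OF Hausdorff completely_regular])
  fix F assume F: "real_filter T F"
  then have nb: "F \<noteq> bot" and evG: "eventually (\<lambda>x. x \<in> carrier G) F" and cc: "countably_complete F"
    and const: "\<And>f. continuous_map T euclideanreal f \<Longrightarrow> \<exists>c. eventually (\<lambda>x. f x = c) F"
    unfolding real_filter_def topspace_eq by auto
  let ?F = "filtermap (\<lambda>x. x <# L) F"
  have ult: "countably_complete_ultrafilter ?F"
    unfolding countably_complete_ultrafilter_def eventually_filtermap filtermap_bot_iff
  proof (intro conjI allI nb countably_complete_filtermap cc)
    fix P
    \<comment> \<open>A property of cosets is decided by its 0-1 indicator, which is continuous and
      hence constant along \<open>F\<close>.\<close>
    obtain c where c: "eventually (\<lambda>x. of_bool (P (x <# L)) = (c :: real)) F"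
      using const[OF continuous_map_coset[OF L(1,2), of "\<lambda>a. of_bool (P a)"]] by blast
    show "eventually (\<lambda>x. P (x <# L)) F \<or> eventually (\<lambda>x. \<not> P (x <# L)) F"
    proof (cases "c = 1")
      case True
      then have "eventually (\<lambda>x. P (x <# L)) F"
        using c by (auto elim: eventually_mono)
      then show ?thesis ..
    next
      case False
      then have "eventually (\<lambda>x. \<not> P (x <# L)) F"
        by (intro eventually_mono[OF c]) auto
      then show ?thesis ..
    qed
  qed
  moreover have "eventually (\<lambda>c. c \<in> (\<lambda>x. x <# L) ` carrier G) ?F"
    unfolding eventually_filtermap by (rule eventually_mono[OF evG]) auto
  ultimately obtain c where "\<not> eventually (\<lambda>d. d \<noteq> c) ?F"
    using principal by blast
  moreover have "eventually (\<lambda>d. d \<noteq> c) ?F \<or> eventually (\<lambda>d. \<not> d \<noteq> c) ?F"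
    using ult unfolding countably_complete_ultrafilter_def by blast
  ultimately have evc: "eventually (\<lambda>x. x <# L = c) F"
    by (simp add: eventually_filtermap)
  obtain a where a: "a \<in> carrier G" "a <# L = c"
    using eventually_happens'[OF nb eventually_conj[OF evG evc]] by blast
  show "\<exists>p. limitin T (\<lambda>x. x) p F"
  proof (rule ccontr)
    assume no: "\<not> ?thesis"
    \<comment> \<open>A real filter that fails to converge to \<open>x\<close> eventually avoids a
      neighbourhood of \<open>x\<close>: a function separating \<open>x\<close> from the complement
      of \<open>V\<close> must have the eventual value 1, since any other value would keep the
      filter in \<open>V\<close>.\<close>
    have "\<exists>W. openin T W \<and> x \<in> W \<and> eventually (\<lambda>y. y \<notin> W) F" if x: "x \<in> carrier G" for x
    proof -
      obtain V where V: "openin T V" "x \<in> V" "\<not> eventually (\<lambda>y. y \<in> V) F"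
        using no x unfolding limitin_def topspace_eq by blast
      obtain f where f: "continuous_map T euclideanreal f" "f x = 0" "f ` (topspace T - V) \<subseteq> {1}"
        using completely_regular V unfolding completely_regular_space_alt' by meson
      obtain c where c: "eventually (\<lambda>y. f y = c) F"
        using const[OF f(1)] by blast
      have "c = 1"
      proof (rule ccontr)
        assume "c \<noteq> 1"
        have "eventually (\<lambda>y. y \<in> V) F"
          using c evG by eventually_elim (use f(3) \<open>c \<noteq> 1\<close> in \<open>auto simp: topspace_eq\<close>)
        then show False using V(3) by simp
      qed
      let ?W = "{y \<in> topspace T. f y \<in> {..<1}}"
      have "openin T ?W"
        by (rule openin_continuous_map_preimage[OF f(1)]) auto
      moreover have "x \<in> ?W" using x f(2) by (simp add: topspace_eq)
      moreover have "eventually (\<lambda>y. y \<notin> ?W) F"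
        using c by (rule eventually_mono) (simp add: \<open>c = 1\<close>)
      ultimately show ?thesis by blast
    qed
    then obtain W where W: "\<And>x. x \<in> carrier G \<Longrightarrow> openin T (W x)"
      "\<And>x. x \<in> carrier G \<Longrightarrow> x \<in> W x" "\<And>x. x \<in> carrier G \<Longrightarrow> eventually (\<lambda>y. y \<notin> W x) F"
      by metis
    \<comment> \<open>Compactness makes \<open>F\<close> avoid each translate
      \<open>a \<otimes> K n\<close>; countable completeness then makes it avoid their union, the
      coset on which it lives.\<close>
    have "eventually (\<lambda>y. y \<notin> (\<lambda>k. a \<otimes> k) ` K n) F" for n
    proof -
      let ?C = "(\<lambda>k. a \<otimes> k) ` K n"
      have C: "compactin T ?C"
        by (rule image_compactin[OF K continuous_map_const_mult(1)[OF a(1)]])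
      have CG: "?C \<subseteq> carrier G"
        using compactin_subset_topspace[OF C] topspace_eq by blast
      have "?C \<subseteq> \<Union>(W ` ?C)" using W(2) CG by blast
      moreover have "\<forall>V\<in>W ` ?C. openin T V" using W(1) CG by blast
      ultimately obtain \<F> where \<F>: "finite \<F>" "\<F> \<subseteq> W ` ?C" "?C \<subseteq> \<Union>\<F>"
        using C unfolding compactin_def by meson
      have "eventually (\<lambda>y. \<forall>V\<in>\<F>. y \<notin> V) F"
        using \<F>(1) by (rule eventually_ball_finite) (use \<F>(2) W(3) CG in blast)
      then show ?thesis
        by (rule eventually_mono) (use \<F>(3) in blast)
    qed
    then have "eventually (\<lambda>y. \<forall>n. y \<notin> (\<lambda>k. a \<otimes> k) ` K n) F"
      by (rule countably_completeD[OF cc])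
    with evG evc have "eventually (\<lambda>y. False) F"
    proof eventually_elim
      case (elim y)
      then have "inv a \<otimes> y \<in> L"
        using l_coset_eq_iff[OF L(1) a(1)] a(2) by blast
      then obtain n where n: "inv a \<otimes> y \<in> K n" using L(3) by blast
      have "y = a \<otimes> (inv a \<otimes> y)"
        using a(1) elim(1) by (simp add: m_assoc[symmetric])
      then show False using elim(3) n by blast
    qed
    then show False using nb by simp
  qed
qed

end


section \<open>The completion\<close>

locale group_completion = G: topological_group G T + H: topological_group H T'
  for G :: "('a, 'm) monoid_scheme" and T and H :: "('b, 'n) monoid_scheme" and T' +
  fixes e :: "'a \<Rightarrow> 'b"
  assumes locally_compact: "locally_compact_space T'"
    and hom: "e \<in> hom G H"
    and embedding: "embedding_map T T' e"
    and dense: "T' closure_of (e ` carrier G) = topspace T'"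
begin

sublocale group_hom G H e
  by unfold_locales (rule hom)

lemma homeomorphic: "homeomorphic_map T (subtopology T' (e ` carrier G)) e"
  using embedding unfolding embedding_map_def G.topspace_eq .

lemma continuous: "continuous_map T T' e"
  using homeomorphic homeomorphic_imp_continuous_map continuous_map_in_subtopology by blast

lemma inj: "inj_on e (carrier G)"
  using homeomorphic_imp_injective_map[OF homeomorphic] by (simp add: G.topspace_eq)

lemma openin_image:
  assumes "openin T U"
  obtains W where "openin T' W" "e ` U = W \<inter> e ` carrier G"
  using homeomorphic_map_openness[OF homeomorphic, of U] openin_subset[OF assms] assms
  unfolding openin_subtopology by blast

text \<open>A missing point of the G_delta-closure is translated close to the identity, into reach
  of a Dieudonne complete closed neighbourhood in \<open>G\<close>. There the trace of its
  neighbourhood filter converges in every metrizable coordinate, hence to a point of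
  \<open>G\<close>.\<close>

lemma gdelta_closed_if_locally_Dieudonne:
  assumes "locally_Dieudonne_complete_space T"
  shows "gdelta_closedin T' (e ` carrier G)"
  unfolding gdelta_closedin_iff
proof (intro conjI ballI)
  let ?Y = "e ` carrier G"
  show YH: "?Y \<subseteq> topspace T'"
    by (auto simp: H.topspace_eq)
  fix p assume p: "p \<in> topspace T' - ?Y"
  then have pH: "p \<in> carrier H" by (simp add: H.topspace_eq)
  show "\<exists>W :: nat \<Rightarrow> 'b set. (\<forall>n. openin T' (W n) \<and> p \<in> W n) \<and> ?Y \<inter> (\<Inter>n. W n) = {}"
  proof (rule ccontr)
    assume none: "\<not> ?thesis"
    have meets: "\<exists>y\<in>?Y. \<forall>n. y \<in> W n" if "\<And>n. openin T' (W n) \<and> p \<in> W n"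
      for W :: "nat \<Rightarrow> 'b set"
    proof -
      have "?Y \<inter> (\<Inter>n. W n) \<noteq> {}"
        using none that by metis
      then show ?thesis by blast
    qed
    obtain U where U: "openin T U" "\<one>\<^bsub>G\<^esub> \<in> U"
      and DU: "Dieudonne_complete_space (subtopology T (T closure_of U))"
      using assms unfolding locally_Dieudonne_complete_space_def G.topspace_eq by blast
    let ?Q = "T closure_of U"
    have UQ: "U \<subseteq> ?Q" "U \<subseteq> carrier G"
      using U(1) closure_of_subset openin_subset G.topspace_eq by metis+
    obtain A where A: "openin T' A" "e ` U = A \<inter> ?Y"
      using openin_image[OF U(1)] by blast
    have "\<one>\<^bsub>H\<^esub> \<in> A"
      using U(2) A(2) hom_one by (metis IntD1 imageI)
    have "continuous_map T' T' (\<lambda>h. inv\<^bsub>H\<^esub> h \<otimes>\<^bsub>H\<^esub> p)"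
      using pH by (intro H.continuous_map_mult H.continuous_inv) (simp add: H.topspace_eq)
    then have "openin T' {h \<in> topspace T'. inv\<^bsub>H\<^esub> h \<otimes>\<^bsub>H\<^esub> p \<in> A}"
      by (rule openin_continuous_map_preimage[OF _ A(1)])
    moreover have "p \<in> {h \<in> topspace T'. inv\<^bsub>H\<^esub> h \<otimes>\<^bsub>H\<^esub> p \<in> A}"
      using pH \<open>\<one>\<^bsub>H\<^esub> \<in> A\<close> by (simp add: H.topspace_eq)
    \<comment> \<open>Density provides an element of \<open>G\<close> whose inverse moves
      \<open>p\<close> into \<open>A\<close>. Since it comes from \<open>G\<close>, the translated
      point \<open>q\<close> is again in the G_delta-closure, and \<open>q\<close> in the image
      would force \<open>p\<close> into the image.\<close>
    ultimately obtain g0 where g0: "g0 \<in> carrier G" "inv\<^bsub>H\<^esub> (e g0) \<otimes>\<^bsub>H\<^esub> p \<in> A"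
      using H.dense_meets[OF dense] by blast
    define q where "q = inv\<^bsub>H\<^esub> (e g0) \<otimes>\<^bsub>H\<^esub> p"
    have qH: "q \<in> carrier H" and qA: "q \<in> A"
      using g0 pH by (auto simp: q_def)
    have qmeets: "\<exists>y\<in>?Y. \<forall>n. y \<in> W n" if W: "\<And>n. openin T' (W n) \<and> q \<in> W n"
      for W :: "nat \<Rightarrow> 'b set"
    proof -
      have "\<exists>y\<in>?Y. \<forall>n. y \<in> {h \<in> carrier H. inv\<^bsub>H\<^esub> (e g0) \<otimes>\<^bsub>H\<^esub> h \<in> W n}"
        using W pH g0(1) unfolding q_def by (intro meets conjI H.openin_translate) auto
      then obtain g where g: "g \<in> carrier G" "\<And>n. inv\<^bsub>H\<^esub> (e g0) \<otimes>\<^bsub>H\<^esub> e g \<in> W n"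
        by blast
      define k where "k = inv\<^bsub>G\<^esub> g0 \<otimes>\<^bsub>G\<^esub> g"
      have "k \<in> carrier G" "\<forall>n. e k \<in> W n"
        using g g0(1) by (simp_all add: k_def)
      then show ?thesis by blast
    qed
    \<comment> \<open>The trace on \<open>?Y \<inter> A\<close> of the neighbourhoods of
      \<open>q\<close>; its image under \<open>e'\<close> lives on \<open>U\<close>.\<close>
    let ?\<Psi> = "inf (nhdsin T' q) (principal (?Y \<inter> A))"
    have ev\<Psi>: "eventually P ?\<Psi>" if "\<And>y. y \<in> ?Y \<inter> A \<Longrightarrow> P y" for P
      unfolding eventually_inf_principal using that by simp
    have nb: "?\<Psi> \<noteq> bot"
    proof
      assume "?\<Psi> = bot"
      then have "eventually (\<lambda>_. False) ?\<Psi>" by simp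
      then obtain W where "openin T' W" "q \<in> W" "\<forall>x\<in>W. x \<notin> ?Y \<inter> A"
        unfolding eventually_inf_principal eventually_nhdsin using qH H.topspace_eq by auto
      then show False
        using H.dense_meets[OF dense, of "W \<inter> A" q] A(1) qA by blast
    qed
    obtain e' where e': "homeomorphic_maps T (subtopology T' ?Y) e e'"
      using homeomorphic homeomorphic_map_maps by blast
    have ee': "e (e' y) = y" if "y \<in> ?Y" for y
      using e' that YH unfolding homeomorphic_maps_def by auto
    have e'e: "e' (e x) = x" if "x \<in> carrier G" for x
      using e' that unfolding homeomorphic_maps_def G.topspace_eq by blast
    have e'U: "e' y \<in> U" if "y \<in> ?Y \<inter> A" for y
    proof -
      have "y \<in> e ` U" using A(2) that by blast
      then show ?thesis using e'e UQ(2) by auto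
    qed
    have ce': "continuous_map (subtopology T' (?Y \<inter> A)) (subtopology T ?Q) e'"
    proof -
      have "continuous_map (subtopology T' (?Y \<inter> A)) T e'"
        using e' continuous_map_from_subtopology_mono[of T' ?Y T e' "?Y \<inter> A"]
        unfolding homeomorphic_maps_def by blast
      then show ?thesis
        using e'U UQ(1) by (auto simp: continuous_map_in_subtopology)
    qed
    obtain I :: "('a topology \<times> ('a \<Rightarrow> 'a)) set" and M :: "_ \<Rightarrow> 'a topology" and C h where
      M: "\<forall>i\<in>I. metrizable_space (M i)" and C: "closedin (product_topology M I) C" and
      h: "homeomorphic_map (subtopology T ?Q) (subtopology (product_topology M I) C) h"
      using DU unfolding Dieudonne_complete_space_def homeomorphic_space by blast
    have ch: "continuous_map (subtopology T ?Q) (M i) (\<lambda>x. h x i)" if "i \<in> I" for i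
    proof -
      have "continuous_map (subtopology T ?Q) (product_topology M I) h"
        using h homeomorphic_imp_continuous_map continuous_map_in_subtopology by blast
      then show ?thesis using that by (simp add: continuous_map_componentwise)
    qed
    let ?F = "filtermap e' ?\<Psi>"
    have "\<exists>m. limitin (M i) (\<lambda>x. h x i) m ?F" if i: "i \<in> I" for i
    proof -
      have "continuous_map (subtopology T' (?Y \<inter> A)) (M i) ((\<lambda>x. h x i) \<circ> e')"
        by (rule continuous_map_compose[OF ce' ch[OF i]])
      then have "\<exists>m. limitin (M i) ((\<lambda>x. h x i) \<circ> e') m ?\<Psi>"
        using M i qmeets YH qA A(1) unfolding H.topspace_eq
        by (intro H.limit_at_gdelta_closure[OF locally_compact _ dense]) auto
      then show ?thesis
        unfolding limitin_def eventually_filtermap o_def .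
    qed
    moreover have "?F \<noteq> bot"
      using nb by (simp add: filtermap_bot_iff)
    moreover have "eventually (\<lambda>x. x \<in> topspace (subtopology T ?Q)) ?F"
      unfolding eventually_filtermap
      by (rule ev\<Psi>) (use e'U UQ G.topspace_eq in auto)
    ultimately obtain g where "limitin (subtopology T ?Q) (\<lambda>x. x) g ?F"
      using closed_in_product_limit[OF C h] by metis
    then have g: "limitin T (\<lambda>x. x) g ?F"
      unfolding limitin_subtopology by blast
    then have gG: "g \<in> carrier G"
      using limitin_topspace G.topspace_eq by metis
    have "limitin T' (e \<circ> (\<lambda>x. x)) (e g) ?F"
      by (rule continuous_map_limit[OF continuous g])
    then have "limitin T' (\<lambda>y. e (e' y)) (e g) ?\<Psi>"
      unfolding limitin_def eventually_filtermap o_def .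
    moreover have "eventually (\<lambda>y. e (e' y) = y) ?\<Psi>"
      by (rule ev\<Psi>) (simp add: ee')
    ultimately have "limitin T' (\<lambda>y. y) (e g) ?\<Psi>"
      \<comment> \<open>The same trace filter converges to \<open>q\<close> by construction, so
        uniqueness of limits identifies \<open>q\<close> with the image of \<open>g\<close>.\<close>
      using limitin_transform_eventually[of "\<lambda>y. e (e' y)" "\<lambda>y. y"] by metis
    moreover have "limitin T' (\<lambda>y. y) q ?\<Psi>"
      unfolding limitin_def eventually_inf_principal eventually_nhdsin
      using qH H.topspace_eq by auto
    ultimately have "e g = q"
      using nb H.Hausdorff by (rule limitin_Hausdorff_unique)
    then have "p = e g0 \<otimes>\<^bsub>H\<^esub> e g"
      using g0(1) pH by (simp add: q_def H.m_assoc[symmetric])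
    also have "\<dots> = e (g0 \<otimes>\<^bsub>G\<^esub> g)"
      using g0(1) gG by simp
    finally show False using p G.m_closed[OF g0(1) gG] by blast
  qed
qed

section \<open>Number of cosets and the precompactness index\<close>

lemma coset_representatives:
  assumes "subgroup L H" "openin T' L" "h \<in> carrier H"
  shows "\<exists>g\<in>carrier G. e g <#\<^bsub>H\<^esub> L = h <#\<^bsub>H\<^esub> L"
  using H.dense_meets[OF dense H.openin_coset_fibre[OF assms], of h] assms(3) by blast

text \<open>Applied to the open subgroup of \<open>G\<close> lying over \<open>L\<close>,
  precompactness gives at most \<open>ip(G)\<close> elements that meet all cosets of
  \<open>L\<close>. A non-principal countably complete ultrafilter on the cosets would therefore
  make \<open>ip(G)\<close> measurable.\<close>

lemma realcompact_completion_if_index_nonmeasurable: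
  assumes "\<not> Ulam_measurable (precompactness_index G T (carrier G))"
  shows "realcompact_space T'"
proof -
  let ?\<tau> = "precompactness_index G T (carrier G)"
  note idx = precompactness_index[OF G.topological_group_axioms order_refl]
  obtain L K where L: "subgroup L H" "openin T' L" "L = (\<Union>n. K n)"
    and K: "\<And>n :: nat. compactin T' (K n)"
    using H.open_sigma_compact_subgroup[OF locally_compact] by blast
  let ?q = "\<lambda>x. x <#\<^bsub>H\<^esub> L"
  let ?U = "{x \<in> carrier G. e x \<in> L}"
  have "openin T ?U"
    using openin_continuous_map_preimage[OF continuous L(2)] by (simp add: G.topspace_eq)
  then have "?U \<in> nhds_one G T"
    using subgroup.one_closed[OF L(1)] by (simp add: nhds_one_def)
  from bspec[OF idx(3)[unfolded card_precompact_in_def] this]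
  obtain S where S: "S \<subseteq> carrier G" "(card_of S, ?\<tau>) \<in> ordLeq" "carrier G \<subseteq> S <#>\<^bsub>G\<^esub> ?U"
    unfolding le_inf_iff by (elim exE conjE)
  have "(card_of S, card_of (Field ?\<tau>)) \<in> ordLeq"
    using S(2) card_of_Field_ordIso[OF idx(1)] ordIso_symmetric ordLeq_ordIso_trans by blast
  then obtain j where j: "inj_on j S" "j ` S \<subseteq> Field ?\<tau>"
    unfolding card_of_ordLeq[symmetric] by blast
  have "\<exists>s\<in>S. ?q (e s) = ?q h" if h: "h \<in> carrier H" for h
  proof -
    obtain g where g: "g \<in> carrier G" "?q (e g) = ?q h"
      using coset_representatives[OF L(1,2) h] by blast
    then obtain s u where su: "s \<in> S" "u \<in> ?U" "g = s \<otimes>\<^bsub>G\<^esub> u"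
      using S(3) unfolding set_mult_def by blast
    then have "inv\<^bsub>H\<^esub> (e s) \<otimes>\<^bsub>H\<^esub> e g = e u"
      using S(1) by (auto simp: H.m_assoc[symmetric])
    then have "?q (e s) = ?q (e g)"
      using H.l_coset_eq_iff[OF L(1), of "e s" "e g"] su(1,2) S(1) g(1) by fastforce
    then show ?thesis using su(1) g(2) by metis
  qed
  then have "\<forall>c\<in>?q ` carrier H. \<exists>s\<in>S. ?q (e s) = c" by blast
  then obtain \<sigma> where \<sigma>: "\<And>c. c \<in> ?q ` carrier H \<Longrightarrow> \<sigma> c \<in> S"
    "\<And>c. c \<in> ?q ` carrier H \<Longrightarrow> ?q (e (\<sigma> c)) = c" by metis
  show ?thesis
  proof (rule H.realcompact_if_cosets_nonmeasurable[OF L K])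
    fix F assume F: "countably_complete_ultrafilter F" "eventually (\<lambda>c. c \<in> ?q ` carrier H) F"
    show "\<exists>c. \<not> eventually (\<lambda>d. d \<noteq> c) F"
    proof (rule ccontr)
      assume "\<not> ?thesis"
      then have at: "eventually (\<lambda>d. d \<noteq> c) F" for c by blast
      let ?F = "filtermap (\<lambda>c. j (\<sigma> c)) F"
      have "eventually (\<lambda>x. x \<in> Field ?\<tau>) ?F"
        unfolding eventually_filtermap by (rule eventually_mono[OF F(2)]) (use \<sigma>(1) j(2) in blast)
      moreover have "eventually (\<lambda>y. y \<noteq> x) ?F" for x
        unfolding eventually_filtermap using at[of "?q (e (inv_into S j x))"] F(2)
      \<comment> \<open>If \<open>x\<close> is the code of a coset, decoding \<open>x\<close>
        recovers that coset, and \<open>F\<close> avoids every single coset.\<close>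
      proof eventually_elim
        case (elim c)
        show ?case
        proof
          assume "j (\<sigma> c) = x"
          then have "inv_into S j x = \<sigma> c"
            using inv_into_f_f[OF j(1) \<sigma>(1)[OF elim(2)]] by simp
          then show False using elim \<sigma>(2) by simp
        qed
      qed
      ultimately have "Ulam_measurable ?\<tau>"
        unfolding Ulam_measurable_iff
        using countably_complete_ultrafilter_filtermap[OF F(1)] by blast
      then show False using assms by blast
    qed
  qed
qed

text \<open>Being \<open>\<sigma>\<close>-compact, \<open>L\<close> is covered by countably many
  translates of a given neighbourhood; multiplying their centres by coset representatives covers the
  whole group. The factor \<open>nat\<close> accounts for these centres.\<close>

lemma card_precompact_cosets:
  assumes L: "subgroup L H" "openin T' L" "L = (\<Union>n. K n)" and K: "\<And>n :: nat. compactin T' (K n)"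
  shows "card_precompact_in G T (card_of ((\<lambda>x. x <#\<^bsub>H\<^esub> L) ` carrier H \<times> (UNIV :: nat set)))
    (carrier G)"
  unfolding card_precompact_in_def
proof (intro ballI)
  let ?q = "\<lambda>x. x <#\<^bsub>H\<^esub> L" and ?Y = "e ` carrier G"
  fix U assume "U \<in> nhds_one G T"
  then have U: "openin T U" "\<one>\<^bsub>G\<^esub> \<in> U" by (auto simp: nhds_one_def)
  obtain W where W: "openin T' W" "e ` U = W \<inter> ?Y"
    using openin_image[OF U(1)] by blast
  have "\<one>\<^bsub>H\<^esub> \<in> W" using U(2) W(2) hom_one by (metis IntD1 imageI)
  then obtain V where V: "openin T' V" "\<one>\<^bsub>H\<^esub> \<in> V" "\<And>x. x \<in> V \<Longrightarrow> inv\<^bsub>H\<^esub> x \<in> V"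
    "\<And>x y. x \<in> V \<Longrightarrow> y \<in> V \<Longrightarrow> x \<otimes>\<^bsub>H\<^esub> y \<in> W"
    using H.symmetric_square_nhd[OF W(1)] by metis
  have VH: "V \<subseteq> carrier H"
    using openin_subset[OF V(1)] H.topspace_eq by blast
  have VU: "g \<in> U" if "g \<in> carrier G" "e g \<in> V" for g
  proof -
    have "e g \<in> W" using V(4)[OF that(2) V(2)] that(1) by simp
    then have "e g \<in> e ` U" using W(2) that(1) by blast
    then show ?thesis
      using inj that(1) openin_subset[OF U(1)] unfolding G.topspace_eq by (auto dest: inj_onD)
  qed
  define B where "B g = {h \<in> carrier H. inv\<^bsub>H\<^esub> (e g) \<otimes>\<^bsub>H\<^esub> h \<in> V}" for g
  have "\<exists>N. finite N \<and> N \<subseteq> carrier G \<and> K n \<subseteq> (\<Union>g\<in>N. B g)" for n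
  proof -
    \<comment> \<open>The centres can be taken in \<open>G\<close>: the admissible centres for
      \<open>h\<close> form an open set containing \<open>h\<close>, which meets the dense
      image.\<close>
    have "\<exists>g\<in>carrier G. h \<in> B g" if "h \<in> carrier H" for h
    proof -
      have "openin T' {y \<in> topspace T'. inv\<^bsub>H\<^esub> y \<otimes>\<^bsub>H\<^esub> h \<in> V}"
        using that by (intro openin_continuous_map_preimage[OF H.continuous_map_mult V(1)] H.continuous_inv)
          (simp add: H.topspace_eq)
      then show ?thesis
        using H.dense_meets[OF dense, of "{y \<in> topspace T'. inv\<^bsub>H\<^esub> y \<otimes>\<^bsub>H\<^esub> h \<in> V}" h] that V(2)
        by (auto simp: B_def H.topspace_eq)
    qed
    moreover have "K n \<subseteq> carrier H"
      using compactin_subset_topspace[OF K] H.topspace_eq by blast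
    ultimately have "K n \<subseteq> \<Union>(B ` carrier G)" by blast
    moreover have "\<forall>B\<in>B ` carrier G. openin T' B"
      using H.openin_translate(1)[OF V(1)] by (auto simp: B_def)
    ultimately obtain \<F> where \<F>: "finite \<F>" "\<F> \<subseteq> B ` carrier G" "K n \<subseteq> \<Union>\<F>"
      using K[of n] unfolding compactin_def by meson
    obtain N where "N \<subseteq> carrier G" "finite N" "\<F> = B ` N"
      using finite_subset_image[OF \<F>(1,2)] by metis
    then show ?thesis using \<F>(3) by (intro exI[of _ N]) simp
  qed
  then obtain N where N: "\<And>n. finite (N n)" "\<And>n. N n \<subseteq> carrier G"
    "\<And>n. K n \<subseteq> (\<Union>g\<in>N n. B g)" by metis
  let ?E = "\<Union>n. N n"
  have E: "countable ?E" "?E \<subseteq> carrier G"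
    using N(1,2) by (auto intro: countable_finite)
  have LE: "L \<subseteq> (\<Union>g\<in>?E. B g)"
    unfolding L(3) using N(3) by (simp add: UN_UN_flatten) blast
  have "?E \<noteq> {}" using LE subgroup.one_closed[OF L(1)] by (metis UN_E empty_iff subsetD)
  define \<epsilon> where "\<epsilon> = from_nat_into ?E"
  have \<epsilon>: "?E = range \<epsilon>"
    using range_from_nat_into[OF \<open>?E \<noteq> {}\<close> E(1)] unfolding \<epsilon>_def by simp
  have \<epsilon>G: "\<epsilon> n \<in> carrier G" for n using \<epsilon> E(2) by blast
  have "\<forall>c\<in>?q ` carrier H. \<exists>g\<in>carrier G. ?q (e g) = c"
    using coset_representatives[OF L(1,2)] by blast
  then obtain \<rho> where \<rho>: "\<And>c. c \<in> ?q ` carrier H \<Longrightarrow> \<rho> c \<in> carrier G"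
    "\<And>c. c \<in> ?q ` carrier H \<Longrightarrow> ?q (e (\<rho> c)) = c" by metis
  let ?t = "\<lambda>c n. \<rho> c \<otimes>\<^bsub>G\<^esub> \<epsilon> n"
  \<comment> \<open>Even indices give the products that cover from the left. Odd indices give their
    inverses, which cover from the right after inverting the covering of
    \<open>inv x\<close>.\<close>
  define s where "s = (\<lambda>(c, n). if even n then ?t c (n div 2) else inv\<^bsub>G\<^esub> (?t c (n div 2)))"
  let ?S = "s ` (?q ` carrier H \<times> UNIV)"
  have SG: "?S \<subseteq> carrier G"
    using \<rho>(1) \<epsilon>G by (auto simp: s_def)
  have tS: "?t c n \<in> ?S" "inv\<^bsub>G\<^esub> (?t c n) \<in> ?S" if "c \<in> ?q ` carrier H" for c n
  proof -
    have "s (c, 2 * n) \<in> ?S" "s (c, 2 * n + 1) \<in> ?S" using that by blast+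
    then show "?t c n \<in> ?S" "inv\<^bsub>G\<^esub> (?t c n) \<in> ?S" by (simp_all add: s_def)
  qed
  have cover: "\<exists>c\<in>?q ` carrier H. \<exists>n. \<exists>u\<in>carrier G. e u \<in> V \<and> x = ?t c n \<otimes>\<^bsub>G\<^esub> u"
    if x: "x \<in> carrier G" for x
  proof -
    let ?c = "?q (e x)"
    have c: "?c \<in> ?q ` carrier H" using x by simp
    have "inv\<^bsub>H\<^esub> (e (\<rho> ?c)) \<otimes>\<^bsub>H\<^esub> e x \<in> L"
      using H.l_coset_eq_iff[OF L(1)] \<rho>[OF c] x by simp
    then obtain n where n: "inv\<^bsub>H\<^esub> (e (\<epsilon> n)) \<otimes>\<^bsub>H\<^esub> (inv\<^bsub>H\<^esub> (e (\<rho> ?c)) \<otimes>\<^bsub>H\<^esub> e x) \<in> V"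
      using LE unfolding \<epsilon> B_def by blast
    let ?u = "inv\<^bsub>G\<^esub> (?t ?c n) \<otimes>\<^bsub>G\<^esub> x"
    have "e ?u = inv\<^bsub>H\<^esub> (e (\<epsilon> n)) \<otimes>\<^bsub>H\<^esub> (inv\<^bsub>H\<^esub> (e (\<rho> ?c)) \<otimes>\<^bsub>H\<^esub> e x)"
      using x \<rho>(1)[OF c] \<epsilon>G by (simp add: G.inv_mult_group H.m_assoc)
    moreover have "?u \<in> carrier G" "x = ?t ?c n \<otimes>\<^bsub>G\<^esub> ?u"
      using x \<rho>(1)[OF c] \<epsilon>G by (simp_all add: G.m_assoc[symmetric])
    ultimately show ?thesis using c n by metis
  qed
  have set_multI: "a \<otimes>\<^bsub>G\<^esub> b \<in> A <#>\<^bsub>G\<^esub> B" if "a \<in> A" "b \<in> B" for a b A B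
    using that unfolding set_mult_def by blast
  have "carrier G \<subseteq> ?S <#>\<^bsub>G\<^esub> U"
  proof
    fix x assume "x \<in> carrier G"
    from cover[OF this]
    obtain c n u where u: "c \<in> ?q ` carrier H" "u \<in> carrier G" "e u \<in> V" "x = ?t c n \<otimes>\<^bsub>G\<^esub> u"
      by (elim bexE exE conjE)
    show "x \<in> ?S <#>\<^bsub>G\<^esub> U"
      unfolding u(4) using tS(1)[OF u(1)] VU[OF u(2,3)] by (rule set_multI)
  qed
  moreover have "carrier G \<subseteq> U <#>\<^bsub>G\<^esub> ?S"
  proof
    fix x assume x: "x \<in> carrier G"
    from cover[OF G.inv_closed[OF x]]
    obtain c n u where u: "c \<in> ?q ` carrier H" "u \<in> carrier G" "e u \<in> V"
      "inv\<^bsub>G\<^esub> x = ?t c n \<otimes>\<^bsub>G\<^esub> u"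
      by (elim bexE exE conjE)
    have tG: "?t c n \<in> carrier G" using \<rho>(1) u(1) \<epsilon>G by simp
    have "x = inv\<^bsub>G\<^esub> (inv\<^bsub>G\<^esub> x)" using x by simp
    also have "\<dots> = inv\<^bsub>G\<^esub> u \<otimes>\<^bsub>G\<^esub> inv\<^bsub>G\<^esub> (?t c n)"
      unfolding u(4) using tG u(2) by (rule G.inv_mult_group)
    finally have eq: "x = inv\<^bsub>G\<^esub> u \<otimes>\<^bsub>G\<^esub> inv\<^bsub>G\<^esub> (?t c n)" .
    have "inv\<^bsub>G\<^esub> u \<in> U"
      using V(3)[OF u(3)] u(2) by (intro VU) auto
    then show "x \<in> U <#>\<^bsub>G\<^esub> ?S"
      using tS(2)[OF u(1)] unfolding eq by (rule set_multI)
  qed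
  ultimately show "\<exists>S\<subseteq>carrier G. (card_of S, card_of (?q ` carrier H \<times> (UNIV :: nat set))) \<in> ordLeq \<and>
      carrier G \<subseteq> (S <#>\<^bsub>G\<^esub> U) \<inter> (U <#>\<^bsub>G\<^esub> S)"
    using SG card_of_image by (intro exI[of _ ?S]) auto
qed

text \<open>The index is bounded by the number of cosets times \<open>\<aleph>\<^sub>0\<close>. A
  non-principal countably complete ultrafilter on it is pushed into \<open>G\<close> by coset
  representatives; convergence there fixes the coset, and the natural number is constant anyway, so
  the ultrafilter would be principal.\<close>

lemma index_nonmeasurable_if_realcompact:
  assumes "realcompact_space T"
  shows "\<not> Ulam_measurable (precompactness_index G T (carrier G))"
proof
  let ?\<tau> = "precompactness_index G T (carrier G)"
  note idx = precompactness_index[OF G.topological_group_axioms order_refl]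
  obtain L K where L: "subgroup L H" "openin T' L" "L = (\<Union>n. K n)"
    and K: "\<And>n :: nat. compactin T' (K n)"
    using H.open_sigma_compact_subgroup[OF locally_compact] by blast
  let ?q = "\<lambda>x. x <#\<^bsub>H\<^esub> L"
  let ?D = "?q ` carrier H \<times> (UNIV :: nat set)"
  have "infinite ?D"
    using H.one_closed by (auto simp: finite_cartesian_product_iff)
  then have "(?\<tau>, card_of ?D) \<in> ordLeq"
    using card_precompact_cosets[OF L K]
    by (intro precompactness_index_least[OF G.topological_group_axioms order_refl])
      (auto simp: Field_card_of card_of_card_order_on)
  then have "(card_of (Field ?\<tau>), card_of ?D) \<in> ordLeq"
    using card_of_Field_ordIso[OF idx(1)] ordIso_ordLeq_trans by blast
  then obtain j where j: "inj_on j (Field ?\<tau>)" "j ` Field ?\<tau> \<subseteq> ?D"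
    unfolding card_of_ordLeq[symmetric] by blast
  assume "Ulam_measurable ?\<tau>"
  then obtain F where F: "countably_complete_ultrafilter F" "eventually (\<lambda>x. x \<in> Field ?\<tau>) F"
    "\<And>x. eventually (\<lambda>y. y \<noteq> x) F"
    unfolding Ulam_measurable_iff by blast
  have nb: "F \<noteq> bot" using F(1) by (simp add: countably_complete_ultrafilter_def)
  have "\<forall>c\<in>?q ` carrier H. \<exists>g\<in>carrier G. ?q (e g) = c"
    using coset_representatives[OF L(1,2)] by blast
  then obtain \<rho> where \<rho>: "\<And>c. c \<in> ?q ` carrier H \<Longrightarrow> \<rho> c \<in> carrier G"
    "\<And>c. c \<in> ?q ` carrier H \<Longrightarrow> ?q (e (\<rho> c)) = c" by metis
  let ?F = "filtermap (\<lambda>x. \<rho> (fst (j x))) F"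
  have jD: "fst (j x) \<in> ?q ` carrier H" if "x \<in> Field ?\<tau>" for x
    using j(2) that by (metis image_subset_iff mem_Times_iff)
  have ult: "countably_complete_ultrafilter ?F"
    by (rule countably_complete_ultrafilter_filtermap[OF F(1)])
  \<comment> \<open>Every real function, continuous or not, is constant along a countably complete
    ultrafilter.\<close>
  have "real_filter T ?F"
    unfolding real_filter_def
  proof (intro conjI allI impI)
    show "eventually (\<lambda>x. x \<in> topspace T) ?F"
      unfolding eventually_filtermap G.topspace_eq
      by (rule eventually_mono[OF F(2)]) (use jD \<rho>(1) in blast)
    show "\<exists>c. eventually (\<lambda>x. f x = c) ?F" for f :: "'a \<Rightarrow> real"
      by (rule countably_complete_ultrafilter_const[OF ult])
  qed (use ult in \<open>auto simp: countably_complete_ultrafilter_def\<close>)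
  then obtain g where g: "limitin T (\<lambda>x. x) g ?F"
    using realcompact_imp_real_filter_converges[OF assms] by metis
  have gG: "g \<in> carrier G" using limitin_topspace[OF g] G.topspace_eq by simp
  \<comment> \<open>The coset of the limit is open, so the chosen representatives eventually belong
    to it.\<close>
  have "openin T {x \<in> topspace T. e x \<in> {h \<in> carrier H. ?q h = ?q (e g)}}"
    using gG by (intro openin_continuous_map_preimage[OF continuous] H.openin_coset_fibre L) simp
  then have "eventually (\<lambda>x. x \<in> {x \<in> topspace T. e x \<in> {h \<in> carrier H. ?q h = ?q (e g)}}) ?F"
    using g gG by (intro limitinD[OF g]) (auto simp: G.topspace_eq)
  then have evg: "eventually (\<lambda>x. ?q (e (\<rho> (fst (j x)))) = ?q (e g)) F"
    unfolding eventually_filtermap by (rule eventually_mono) auto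
  \<comment> \<open>The second coordinate is regarded as a real number to apply the same constancy
    result; with both coordinates fixed, injectivity of \<open>j\<close> leaves a single
    point.\<close>
  obtain r where evr: "eventually (\<lambda>x. real (snd (j x)) = r) F"
    using countably_complete_ultrafilter_const[OF F(1), of "\<lambda>x. real (snd (j x))"] by blast
  let ?P = "\<lambda>x. x \<in> Field ?\<tau> \<and> fst (j x) = ?q (e g) \<and> real (snd (j x)) = r"
  have evP: "eventually ?P F"
    using evg evr F(2) by eventually_elim (use \<rho>(2) jD in metis)
  then obtain a where a: "?P a"
    using eventually_happens'[OF nb] by blast
  have "eventually (\<lambda>x. False) F"
    using evP F(3)[of a]
  proof eventually_elim
    case (elim x)
    then have "j x = j a" using a by (simp add: prod_eq_iff)
    then show False using elim a j(1) by (auto dest: inj_onD)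
  qed
  then show False using nb by simp
qed

lemma realcompact_if_completion_realcompact:
  assumes "realcompact_space T'" "gdelta_closedin T' (e ` carrier G)"
  shows "realcompact_space T"
proof -
  have "realcompact_space (subtopology T' (e ` carrier G))"
    by (rule realcompact_gdelta_closedin[OF H.Hausdorff H.completely_regular assms])
  then show ?thesis
    by (rule realcompact_space_homeomorphic[OF homeomorphic_map_imp_homeomorphic_space[OF homeomorphic]])
qed

end

theorem theorem2p23:
  fixes G :: "('a, 'm) monoid_scheme" and T :: "'a topology"
    and H :: "('b, 'n) monoid_scheme" and T' :: "'b topology"
    and e :: "'a \<Rightarrow> 'b"
  assumes "topological_group G T"
    and "locally_precompact G T"
    and "is_completion G T H T' e"
  shows "let ip_ok = (\<not> Ulam_measurable (precompactness_index G T (carrier G)));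
             i = (locally_realcompact_space T \<and> ip_ok);
             ii = (Dieudonne_complete_space T \<and> ip_ok);
             iii = (locally_Dieudonne_complete_space T \<and> ip_ok);
             iv = (gdelta_closedin T' (e ` carrier G) \<and> ip_ok);
             v = (realcompact_space T' \<and> gdelta_closedin T' (e ` carrier G));
             vi = realcompact_space T
         in (i \<longleftrightarrow> ii) \<and> (ii \<longleftrightarrow> iii) \<and> (iii \<longleftrightarrow> iv) \<and> (iv \<longleftrightarrow> v) \<and> (v \<longleftrightarrow> vi)"
proof -
  interpret group_completion G T H T' e
    using assms(1,3) unfolding is_completion_def
    by (intro group_completion.intro group_completion_axioms.intro) auto
  have "locally_realcompact_space T \<Longrightarrow> locally_Dieudonne_complete_space T"
    by (rule locally_realcompact_imp_locally_Dieudonne)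
  moreover have "Dieudonne_complete_space T \<Longrightarrow> locally_Dieudonne_complete_space T"
    by (rule Dieudonne_complete_imp_locally)
  moreover have "realcompact_space T \<Longrightarrow> locally_realcompact_space T"
    by (rule realcompact_imp_locally_realcompact)
  moreover have "realcompact_space T \<Longrightarrow> Dieudonne_complete_space T"
    by (rule realcompact_imp_Dieudonne_complete)
  \<comment> \<open>Each of (i) and (ii) gives (iii), which gives (iv) by the limit argument; the
    index bound gives (v), passage to the G_delta-closed subgroup gives (vi), and (vi) returns the
    local and global completeness together with the index bound.\<close>
  ultimately show ?thesis
    using gdelta_closed_if_locally_Dieudonne realcompact_completion_if_index_nonmeasurable
      index_nonmeasurable_if_realcompact realcompact_if_completion_realcompact
    unfolding Let_def by argo
qed

end
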